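(* Let $d\ge1$, $k\ge 2$, let $R$ be the irrational rotation of $\mathbb T^d$ by $a$ and $U_1,\ldots,U_k\subset\mathbb T^d$ the open sets with closures $P_1,\ldots,P_k$ satisfying the assumptions listed in the context, let $Y\subset\{1,\ldots,k\}^{\mathbb Z}$ be the associated symbolic coding system, and let $Z=\operatorname{Spoke}(Y)$. Then: (1) $(Z,\sigma)$ has CPMD. (2) $(Z,\sigma)$ does not have UPMD. More precisely, there is a standard open cover $\beta=\{W_0,W_1\}$ of $Z$ such that $\operatorname{mdim}(Z,\sigma,\beta)=0$ and, moreover, $$\mathcal N(\beta_0^{n-1})\ge n+1\qquad(n\ge1).$$ If, in addition, the elements $P_i$ of the partition of the torus are given by rectangles with sides parallel to the standard basis vectors (i.e. each $\widetilde P_i$ is a product of closed intervals), then there is $C>0$ such that $$\mathcal N(\beta_0^{n-1})\le Cn^d\qquad(n\ge1),$$ and hence $h_{\mathrm{top}}(Z,\sigma,\beta)=0$; in this case $(Z,\sigma)$ has neither UPMD nor UPE.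
   Context: Dynamical notions. A topological dynamical system $(X,T)$ is a compact metrizable space $X$ with a homeomorphism $T$. For a finite open cover $\mathcal U$ of $X$: $\mathcal U_0^{n-1}=\bigvee_{i=0}^{n-1}T^{-i}\mathcal U$; $\mathcal N(\mathcal U)$ is the minimal cardinality of a subcover; $h_{\mathrm{top}}(X,T,\mathcal U)=\lim_n\frac1n\log\mathcal N(\mathcal U_0^{n-1})$; $\operatorname{ord}(\mathcal U)=\max_{x}\#\{U\in\mathcal U:x\in U\}-1$; $\mathcal D(\mathcal U)=\min\operatorname{ord}(\gamma)$ over finite open covers $\gamma$ refining $\mathcal U$; $\operatorname{mdim}(X,T,\mathcal U)=\lim_n\mathcal D(\mathcal U_0^{n-1})/n$; $\operatorname{mdim}(X,T)=\sup_{\mathcal U}\operatorname{mdim}(X,T,\mathcal U)$. A standard open cover is a two-element open cover neither of whose elements is dense. $(X,T)$ has UPE (resp. UPMD) if $h_{\mathrm{top}}(X,T,\mathcal U)>0$ (resp. $\operatorname{mdim}(X,T,\mathcal U)>0$) for every standard open cover $\mathcal U$. $(X,T)$ has CPMD if it has no nontrivial (more than one point) topological factor with zero mean dimension. On sequence spaces $\sigma$ is the left shift $(\sigma x)_m=x_{m+1}$. Rotation coding. Let $\mathbb T^d=\mathbb R^d/\mathbb Z^d$, $q:\mathbb R^d\to\mathbb T^d$ the quotient map, $a=(a_1,\ldots,a_d)\in\mathbb R^d$ with $1,a_1,\ldots,a_d$ rationally independent, and $R(v)=v+a$ on $\mathbb T^d$. Let $k\ge2$ and let $U_1,\ldots,U_k\subset\mathbb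 T^d$ be pairwise disjoint nonempty open sets, $P_i=\overline{U_i}$, with $\mathbb T^d=\bigcup_iP_i$ and $U_i=\operatorname{int}(P_i)$. Assume that for every $i$ there is a compact convex set $\widetilde P_i\subset\mathbb R^d$ with $q(\widetilde P_i)=P_i$ and Euclidean diameter $\operatorname{diam}(\widetilde P_i)<\frac12$. Put $B=\bigcup_i\partial P_i$ and $\mathbb T^d_{\rm reg}=\mathbb T^d\setminus\bigcup_{m\in\mathbb Z}R^{-m}B$. For $v\in\mathbb T^d_{\rm reg}$ define $c(v)\in\{1,\ldots,k\}^{\mathbb Z}$ by $c(v)_m=i\iff R^mv\in U_i$. Let $Y=\overline{c(\mathbb T^d_{\rm reg})}\subset\{1,\ldots,k\}^{\mathbb Z}$, a closed shift-invariant set. Hub-and-spoke system. Let $\overline{\mathbb D}$ be the closed unit disk in $\mathbb R^2$, fix distinct points $p_1,\ldots,p_k\in\partial\mathbb D$, define $\Phi(y,\rho)_m=\rho_mp_{y_m}$ for $y\in Y$, $\rho\in[0,1]^{\mathbb Z}$, and $\operatorname{Spoke}(Y)=\Phi(Y\times[0,1]^{\mathbb Z})\subset\overline{\mathbb D}^{\mathbb Z}$, a closed shift-invariant set. *)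

theory Defs
  imports "HOL-Analysis.Analysis"
begin

section \<open>Topological dynamical systems and open covers\<close>

definition top_dyn_system :: "'a topology \<Rightarrow> ('a \<Rightarrow> 'a) \<Rightarrow> bool" where
  "top_dyn_system X T \<longleftrightarrow> compact_space X \<and> metrizable_space X \<and> homeomorphic_map X X T"

definition finite_open_cover :: "'a topology \<Rightarrow> 'a set set \<Rightarrow> bool" where
  "finite_open_cover X \<U> \<longleftrightarrow> finite \<U> \<and> (\<forall>A\<in>\<U>. openin X A) \<and> \<Union>\<U> = topspace X"

definition refines :: "'a set set \<Rightarrow> 'a set set \<Rightarrow> bool" where
  "refines \<V> \<U> \<longleftrightarrow> (\<forall>V\<in>\<V>. \<exists>U\<in>\<U>. V \<subseteq> U)"

text \<open>\<^term>\<open>iterated_cover X T \<U> n\<close> is the join of the covers \<open>T\<^sup>-\<^sup>i \<U>\<close> for \<open>0 \<le> i \<le> n - 1\<close>.\<close>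

definition iterated_cover :: "'a topology \<Rightarrow> ('a \<Rightarrow> 'a) \<Rightarrow> 'a set set \<Rightarrow> nat \<Rightarrow> 'a set set" where
  "iterated_cover X T \<U> n =
     {topspace X \<inter> (\<Inter>i<n. (T ^^ i) -` f i) | f. \<forall>i<n. f i \<in> \<U>}"

definition subcover_number :: "'a topology \<Rightarrow> 'a set set \<Rightarrow> nat" where
  "subcover_number X \<U> = Inf {card \<V> | \<V>. \<V> \<subseteq> \<U> \<and> finite \<V> \<and> \<Union>\<V> = topspace X}"

definition cover_ord :: "'a topology \<Rightarrow> 'a set set \<Rightarrow> nat" where
  "cover_ord X \<U> = Max ((\<lambda>x. card {U \<in> \<U>. x \<in> U}) ` topspace X) - 1"

definition cover_dim :: "'a topology \<Rightarrow> 'a set set \<Rightarrow> nat" where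
  "cover_dim X \<U> = Inf {cover_ord X \<gamma> | \<gamma>. finite_open_cover X \<gamma> \<and> refines \<gamma> \<U>}"


section \<open>Entropy and mean dimension\<close>

definition htop_cover :: "'a topology \<Rightarrow> ('a \<Rightarrow> 'a) \<Rightarrow> 'a set set \<Rightarrow> real" where
  "htop_cover X T \<U> =
     lim (\<lambda>n. ln (real (subcover_number X (iterated_cover X T \<U> n))) / real n)"

definition mdim_cover :: "'a topology \<Rightarrow> ('a \<Rightarrow> 'a) \<Rightarrow> 'a set set \<Rightarrow> real" where
  "mdim_cover X T \<U> = lim (\<lambda>n. real (cover_dim X (iterated_cover X T \<U> n)) / real n)"

definition mdim :: "'a topology \<Rightarrow> ('a \<Rightarrow> 'a) \<Rightarrow> ereal" where
  "mdim X T = (SUP \<U> \<in> {\<U>. finite_open_cover X \<U>}. ereal (mdim_cover X T \<U>))"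

definition standard_open_cover :: "'a topology \<Rightarrow> 'a set set \<Rightarrow> bool" where
  "standard_open_cover X \<U> \<longleftrightarrow>
     finite_open_cover X \<U> \<and> card \<U> = 2 \<and> (\<forall>U\<in>\<U>. X closure_of U \<noteq> topspace X)"

definition has_UPE :: "'a topology \<Rightarrow> ('a \<Rightarrow> 'a) \<Rightarrow> bool" where
  "has_UPE X T \<longleftrightarrow> (\<forall>\<U>. standard_open_cover X \<U> \<longrightarrow> htop_cover X T \<U> > 0)"

definition has_UPMD :: "'a topology \<Rightarrow> ('a \<Rightarrow> 'a) \<Rightarrow> bool" where
  "has_UPMD X T \<longleftrightarrow> (\<forall>\<U>. standard_open_cover X \<U> \<longrightarrow> mdim_cover X T \<U> > 0)"

definition factor_map ::
  "'a topology \<Rightarrow> ('a \<Rightarrow> 'a) \<Rightarrow> 'b topology \<Rightarrow> ('b \<Rightarrow> 'b) \<Rightarrow> ('a \<Rightarrow> 'b) \<Rightarrow> bool" where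
  "factor_map X T Y S \<pi> \<longleftrightarrow>
     continuous_map X Y \<pi> \<and> \<pi> ` topspace X = topspace Y \<and> (\<forall>x\<in>topspace X. \<pi> (T x) = S (\<pi> x))"

text \<open>HOL cannot quantify over the types carrying the factors inside a definition, so the carrier
  type \<open>'b\<close> is a parameter; a theorem about \<^term>\<open>has_CPMD TYPE('b) X T\<close> with \<open>'b\<close> a type variable
  covers factors on every type.  (A compact metrizable space has at most continuum many points, so
  any \<open>'b\<close> of at least that cardinality already represents all factors.)\<close>

definition has_CPMD :: "'b itself \<Rightarrow> 'a topology \<Rightarrow> ('a \<Rightarrow> 'a) \<Rightarrow> bool" where
  "has_CPMD (_ :: 'b itself) X T \<longleftrightarrow>
     \<not> (\<exists>(Y :: 'b topology) S \<pi>. top_dyn_system Y S \<and> factor_map X T Y S \<pi> \<and>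
          (\<exists>y\<in>topspace Y. \<exists>y'\<in>topspace Y. y \<noteq> y') \<and> mdim Y S = 0)"


section \<open>The torus and its rotations\<close>

quotient_type (overloaded) 'd torus = "real ^ ('d::finite)" / "\<lambda>x y. \<forall>i. x $ i - y $ i \<in> \<int>"
  morphisms torus_rep torus_proj
proof (rule equivpI)
  show "reflp (\<lambda>(x :: real ^ 'd) y. \<forall>i. x $ i - y $ i \<in> \<int>)"
    by (simp add: reflp_def)
  show "symp (\<lambda>(x :: real ^ 'd) y. \<forall>i. x $ i - y $ i \<in> \<int>)"
    unfolding symp_def by (metis Ints_minus minus_diff_eq)
  show "transp (\<lambda>(x :: real ^ 'd) y. \<forall>i. x $ i - y $ i \<in> \<int>)"
    unfolding transp_def by (metis Ints_add diff_add_cancel add_diff_eq)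
qed

text \<open>The quotient topology.\<close>

instantiation torus :: (finite) topological_space
begin

definition open_torus :: "'a torus set \<Rightarrow> bool" where
  "open_torus S \<longleftrightarrow> open (torus_proj -` S)"

instance
  by standard (auto simp: open_torus_def vimage_Union)

end

lift_definition rotation :: "real ^ 'd \<Rightarrow> 'd::finite torus \<Rightarrow> 'd torus" is "\<lambda>a v. v + a"
  by simp

definition int_iterate :: "('a \<Rightarrow> 'a) \<Rightarrow> int \<Rightarrow> 'a \<Rightarrow> 'a" where
  "int_iterate f m = (if m \<ge> 0 then f ^^ nat m else inv f ^^ nat (- m))"

definition rationally_independent_with_one :: "real ^ 'd::finite \<Rightarrow> bool" where
  "rationally_independent_with_one a \<longleftrightarrow>
     (\<forall>(c0 :: rat) (c :: 'd \<Rightarrow> rat).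
        of_rat c0 + (\<Sum>i\<in>UNIV. of_rat (c i) * a $ i) = 0 \<longrightarrow> c0 = 0 \<and> (\<forall>i. c i = 0))"


section \<open>Rotation coding and hub-and-spoke systems\<close>

text \<open>The pieces are indexed by \<open>{1..k}\<close> and \<open>P\<^sub>i\<close> is \<^term>\<open>closure (U i)\<close>.  Sequences over the
  alphabet live in \<^typ>\<open>int \<Rightarrow> nat\<close> with the product of the discrete topologies.\<close>

definition regular_points :: "real ^ 'd \<Rightarrow> nat \<Rightarrow> (nat \<Rightarrow> 'd::finite torus set) \<Rightarrow> 'd torus set" where
  "regular_points a k U =
     - (\<Union>m. int_iterate (rotation a) m -` (\<Union>i\<in>{1..k}. frontier (closure (U i))))"

definition coding :: "real ^ 'd \<Rightarrow> nat \<Rightarrow> (nat \<Rightarrow> 'd::finite torus set) \<Rightarrow> 'd torus \<Rightarrow> int \<Rightarrow> nat" where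
  "coding a k U v m = (THE i. i \<in> {1..k} \<and> int_iterate (rotation a) m v \<in> U i)"

definition coding_system :: "real ^ 'd \<Rightarrow> nat \<Rightarrow> (nat \<Rightarrow> 'd::finite torus set) \<Rightarrow> (int \<Rightarrow> nat) set" where
  "coding_system a k U = closure (coding a k U ` regular_points a k U)"

definition Spoke :: "(nat \<Rightarrow> real ^ 2) \<Rightarrow> (int \<Rightarrow> nat) set \<Rightarrow> (int \<Rightarrow> real ^ 2) set" where
  "Spoke p Y = (\<lambda>(y, \<rho>) m. \<rho> m *\<^sub>R p (y m)) ` (Y \<times> {\<rho>. \<forall>m. \<rho> m \<in> {0..1}})"

definition left_shift :: "(int \<Rightarrow> 'a) \<Rightarrow> int \<Rightarrow> 'a" where
  "left_shift x m = x (m + 1)"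

end

theory Submission
  imports Defs
begin

text \<open>
  A point of the hub-and-spoke system \<open>Z\<close> consists of an address \<open>y \<in> Y\<close> and radii \<open>\<rho>\<close>; the
  address is visible only where the radius is positive.

  \<^emph>\<open>Completely positive mean dimension.\<close>  Let \<open>\<pi>\<close> be a factor map onto a system with two points.  Some
  \<open>z \<in> Z\<close> has \<open>\<pi> z \<noteq> \<pi> 0\<close>, and finitely many coordinates of a point decide whether its image is near
  \<open>\<pi> z\<close> or near \<open>\<pi> 0\<close>.  The address word of \<open>z\<close> on this window recurs with positive density in one
  orbit, along times \<open>n\<^sub>1, n\<^sub>2, \<dots>\<close> with disjoint windows; scaling the radii of the copy of \<open>z\<close> at \<open>n\<^sub>i\<close>
  by \<open>t\<^sub>i \<in> [0,1]\<close> gives a cube of points whose faces \<open>t\<^sub>i = 1\<close> and \<open>t\<^sub>i = 0\<close> are carried near \<open>\<pi> z\<close> and near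
  \<open>\<pi> 0\<close> at time \<open>n\<^sub>i\<close> (\<open>independent_copies\<close>).  Lebesgue's covering theorem (\<open>Lebesgue_covering\<close>)
  then makes the dimension of the iterated two-element cover of the factor grow linearly.  For this to
  bound the mean dimension of the factor, the defining limit has to exist; this is the subadditivity
  of the dimension of joins (\<open>cover_dim_join_le\<close>).

  \<^emph>\<open>No uniformly positive mean dimension.\<close>  The cover \<open>\<beta>\<close> only distinguishes \<open>z\<^sub>0\<close> far out on spoke \<open>1\<close>
  from \<open>z\<^sub>0\<close> far out on another spoke.  If some \<open>z\<^sub>i\<close> with \<open>0 \<le> i < n\<close> is away from the hub, the points
  of the torus whose codings agree with \<open>z\<close> at its large coordinates form a set that lifts to a
  convex set of diameter less than \<open>1/2\<close>, so averaging finitely many sample points with weights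
  depending continuously on \<open>z\<close> chooses a point of it (\<open>continuous_section\<close>).  Pulling back a fine
  grid of the torus by this choice refines the iterated cover by a cover whose order is at most
  \<open>2\<^sup>d\<close>, whatever \<open>n\<close> is.

  \<^emph>\<open>Growth.\<close>  Points with all radii \<open>1\<close> lie in a single member of the iterated cover, so the minimal
  subcovers have as many members as the coding by \<open>U\<^sub>1\<close> and its complement has words of length \<open>n\<close>
  (\<open>subcover_number_eq\<close>).  If the number of words did not increase at some step, the coding would be
  periodic, and iterating the rotation by a multiple of \<open>a\<close> would keep a lift in the bounded set
  \<open>P'\<^sub>1\<close>, which forces \<open>a\<close> to be rational.  If \<open>P'\<^sub>1\<close> is a box, each coordinate of a point influences
  the word only through its position relative to \<open>2n\<close> points of the circle, so there are \<open>O(n\<^sup>d)\<close>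
  words.
\<close>

section \<open>A covering theorem for cubes\<close>

text \<open>An infinite product serves as the domain of cubes of every dimension, since the dimension of a
  Euclidean space is fixed by its type.\<close>

definition hilbert_cube :: "(nat \<Rightarrow> real) set" where
  "hilbert_cube = {t. \<forall>i. t i \<in> {0..1}}"

lemma compact_hilbert_cube: "compact hilbert_cube"
proof -
  have "hilbert_cube = PiE UNIV (\<lambda>_. {0..1})"
    by (auto simp: hilbert_cube_def PiE_def Pi_def)
  moreover have "compactin (product_topology (\<lambda>_::nat. euclidean) UNIV) (PiE UNIV (\<lambda>_. {0..1::real}))"
    by (auto simp: compactin_PiE)
  ultimately show ?thesis
    by (simp add: euclidean_product_topology flip: compactin_euclidean_iff)
qed

lemma dist_fun_le:
  fixes x y :: "nat \<Rightarrow> real"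
  assumes "\<And>i. dist (x i) (y i) \<le> e"
  shows "dist x y \<le> 2 * e"
proof -
  have e: "0 \<le> e" using assms[of 0] zero_le_dist order_trans by blast
  have "dist x y \<le> (\<Sum>n. (1/2)^n * e)"
    unfolding dist_fun_def
  proof (rule suminf_le)
    show "summable (\<lambda>n. (1 / 2) ^ n * min (dist (x (from_nat n)) (y (from_nat n))) 1)"
      by (rule summable_comparison_test'[of "\<lambda>n. (1/2)^n"]) (auto simp: summable_geometric_iff)
    show "summable (\<lambda>n. (1/2)^n * e)"
      by (intro summable_mult2) (simp add: summable_geometric_iff)
    show "(1 / 2) ^ n * min (dist (x (from_nat n)) (y (from_nat n))) 1 \<le> (1/2)^n * e" for n
      by (intro mult_left_mono) (use assms[of "from_nat n"] in \<open>auto simp: min_le_iff_disj\<close>)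
  qed
  also have "\<dots> = 2 * e"
    by (subst suminf_mult2[symmetric]) (auto simp: summable_geometric_iff suminf_geometric)
  finally show ?thesis .
qed

text \<open>Lebesgue's covering theorem, from Kuhn's cubical version of Sperner's lemma.  Give each grid point a
  member of the cover that contains a ball around it, and let the \<open>i\<close>-th label of the grid point say
  whether this member meets the face \<open>t\<^sub>i = 1\<close>.  Kuhn's lemma yields a small simplex whose vertices
  carry \<open>K + 1\<close> different reduced labels; a reduced label depends only on the chosen member, so
  \<open>K + 1\<close> different members are involved, and all of them contain every vertex.\<close>

lemma Lebesgue_covering:
  assumes fin: "finite \<V>"
    and op: "\<And>V. V \<in> \<V> \<Longrightarrow> openin (top_of_set hilbert_cube) V"
    and cov: "hilbert_cube \<subseteq> \<Union>\<V>"
    and opp: "\<And>V i x y. V \<in> \<V> \<Longrightarrow> i < K \<Longrightarrow> x \<in> V \<Longrightarrow> y \<in> V \<Longrightarrow> x i = 0 \<Longrightarrow> y i = 1 \<Longrightarrow> False"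
  shows "\<exists>x\<in>hilbert_cube. K + 1 \<le> card {V \<in> \<V>. x \<in> V}"
proof -
  have "\<forall>V. \<exists>G. V \<in> \<V> \<longrightarrow> open G \<and> V = hilbert_cube \<inter> G"
    using op by (auto simp: openin_open)
  then obtain G where G: "\<And>V. V \<in> \<V> \<Longrightarrow> open (G V) \<and> V = hilbert_cube \<inter> G V"
    by metis
  have "hilbert_cube \<subseteq> \<Union>(G ` \<V>)" using cov G by blast
  moreover have "\<And>B. B \<in> G ` \<V> \<Longrightarrow> open B" using G by auto
  moreover have "(\<lambda>_. 0) \<in> hilbert_cube" by (simp add: hilbert_cube_def)
  then have "G ` \<V> \<noteq> {}" using cov by blast
  ultimately obtain d where d: "d > 0"
    "\<And>T. \<lbrakk>T \<subseteq> hilbert_cube; diameter T < d\<rbrakk> \<Longrightarrow> \<exists>B\<in>G ` \<V>. T \<subseteq> B"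
    using Lebesgue_number_lemma[OF compact_hilbert_cube, of "G ` \<V>"] by metis
  define e where "e = d / 4"
  have e: "e > 0" "\<forall>x\<in>hilbert_cube. \<exists>B\<in>G ` \<V>. ball x e \<inter> hilbert_cube \<subseteq> B"
  proof -
    show "e > 0" using d by (simp add: e_def)
    have "diameter (ball x e \<inter> hilbert_cube) \<le> 2 * e" for x :: "nat \<Rightarrow> real"
    proof (cases "ball x e \<inter> hilbert_cube = {}")
      case False
      have "dist y z \<le> 2 * e" if "y \<in> ball x e" "z \<in> ball x e" for y z
        using that dist_triangle2[of y z x] by (auto simp: dist_commute)
      then show ?thesis
        unfolding diameter_def using False by (auto intro!: cSUP_least)
    qed (use \<open>e > 0\<close> in \<open>auto simp: diameter_def\<close>)
    moreover have "2 * e < d" using d(1) by (simp add: e_def)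
    ultimately have "diameter (ball x e \<inter> hilbert_cube) < d" for x :: "nat \<Rightarrow> real"
      using le_less_trans by blast
    then show "\<forall>x\<in>hilbert_cube. \<exists>B\<in>G ` \<V>. ball x e \<inter> hilbert_cube \<subseteq> B"
      using d(2) by blast
  qed
  then have "\<forall>x. \<exists>V. x \<in> hilbert_cube \<longrightarrow> V \<in> \<V> \<and> ball x e \<inter> hilbert_cube \<subseteq> V"
    using G by (metis (no_types, lifting) image_iff inf.cobounded2 le_inf_iff)
  then obtain s where s: "\<And>x. x \<in> hilbert_cube \<Longrightarrow> s x \<in> \<V> \<and> ball x e \<inter> hilbert_cube \<subseteq> s x"
    by metis
  obtain p :: nat where p: "p > 0" "2 / real p < e"
  proof -
    obtain p :: nat where "2 / e < real p" using reals_Archimedean2 by blast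
    moreover from this have "p > 0" using e(1) by (auto intro!: gr0I simp: field_simps)
    ultimately show ?thesis using e(1) by (intro that[of p]) (auto simp: field_simps)
  qed
  define pt :: "(nat \<Rightarrow> nat) \<Rightarrow> nat \<Rightarrow> real" where "pt x i = real (x i) / real p" for x i
  define lab :: "(nat \<Rightarrow> nat) \<Rightarrow> nat \<Rightarrow> nat" where
    "lab x i = (if \<exists>y \<in> s (pt x). y i = 1 then 1 else 0)" for x i
  have pt: "pt x \<in> hilbert_cube" if "\<forall>j. x j \<le> p" for x
    using that p(1) by (auto simp: hilbert_cube_def pt_def)
  have self: "x \<in> s x" if "x \<in> hilbert_cube" for x
    using s[OF that] that e(1) by auto
  have "odd (card {S. ksimplex p K S \<and> (reduced K \<circ> lab) ` S = {..K}})"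
  proof (rule kuhn_combinatorial[OF p(1)])
    show "\<forall>x j. (\<forall>j. x j \<le> p) \<and> j < K \<and> x j = 0 \<longrightarrow> lab x j = 0"
    proof safe
      fix x j assume x: "\<forall>j. x j \<le> p" "j < K" "x j = 0"
      have "pt x j = 0" using x by (simp add: pt_def)
      then show "lab x j = 0"
        using opp[of "s (pt x)" j "pt x"] s self pt x by (auto simp: lab_def)
    qed
    show "\<forall>x j. (\<forall>j. x j \<le> p) \<and> j < K \<and> x j = p \<longrightarrow> lab x j = 1"
    proof safe
      fix x j assume x: "\<forall>i. x i \<le> x j" "j < K" "p = x j"
      have "pt x j = 1" using x p by (simp add: pt_def)
      then show "lab x j = 1"
        using self pt x by (auto simp: lab_def)
    qed
  qed
  then have "{S. ksimplex p K S \<and> (reduced K \<circ> lab) ` S = {..K}} \<noteq> {}"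
    by (rule odd_card_imp_not_empty)
  then obtain S b u where ks: "kuhn_simplex p K b u S" and rl: "(reduced K \<circ> lab) ` S = {..K}"
    by (auto elim: ksimplex.cases)
  interpret kuhn_simplex p K b u S by fact
  \<comment> \<open>The vertices of a simplex differ by at most one grid step in each coordinate.\<close>
  have near: "dist (pt x) (pt y) < e" if "x \<in> S" "y \<in> S" for x y
  proof -
    have "dist (pt x i) (pt y i) \<le> 1 / real p" for i
    proof -
      have "\<bar>real (x i) - real (y i)\<bar> \<le> 1"
        using base_le[OF that(1), of i] base_le[OF that(2), of i]
          le_Suc_base[OF that(1), of i] le_Suc_base[OF that(2), of i] by linarith
      then show ?thesis using p(1)
        by (simp add: dist_real_def pt_def flip: diff_divide_distrib) (simp add: divide_right_mono)
    qed
    then have "dist (pt x) (pt y) \<le> 2 * (1 / real p)" by (rule dist_fun_le)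
    with p(2) show ?thesis by simp
  qed
  have cube: "pt x \<in> hilbert_cube" if "x \<in> S" for x
    using that s_le_p by (intro pt) auto
  obtain x0 where x0: "x0 \<in> S" using base_in_s by blast
  have sub: "(s \<circ> pt) ` S \<subseteq> {V \<in> \<V>. pt x0 \<in> V}"
  proof safe
    fix x assume x: "x \<in> S"
    show "(s \<circ> pt) x \<in> \<V>" using s cube x by auto
    show "pt x0 \<in> (s \<circ> pt) x"
      using s[OF cube[OF x]] near[OF x x0] cube[OF x0] by auto
  qed
  \<comment> \<open>The reduced label of a vertex depends only on the member chosen for it.\<close>
  define r where "r V = reduced K (\<lambda>i. if \<exists>y \<in> V. y i = 1 then 1 else 0)" for V :: "(nat \<Rightarrow> real) set"
  have "reduced K \<circ> lab = r \<circ> (s \<circ> pt)"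
    by (simp add: r_def lab_def[abs_def] fun_eq_iff)
  then have "{..K} = r ` ((s \<circ> pt) ` S)"
    using rl by (simp add: image_comp)
  then have "card {..K} \<le> card ((s \<circ> pt) ` S)"
    by (metis (no_types, lifting) card_image_le fin finite_subset mem_Collect_eq sub subsetI)
  also have "\<dots> \<le> card {V \<in> \<V>. pt x0 \<in> V}"
    using sub fin by (intro card_mono) auto
  finally show ?thesis using cube[OF x0] by auto
qed

section \<open>Subadditivity of the dimension of covers\<close>

lemma card_le_cover_ord:
  assumes "finite \<gamma>" "x \<in> topspace X"
  shows "card {U \<in> \<gamma>. x \<in> U} \<le> cover_ord X \<gamma> + 1"
proof -
  have "finite ((\<lambda>x. card {U \<in> \<gamma>. x \<in> U}) ` topspace X)"
    by (rule finite_subset[of _ "{..card \<gamma>}"]) (auto intro!: card_mono assms)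
  then have "card {U \<in> \<gamma>. x \<in> U} \<le> Max ((\<lambda>x. card {U \<in> \<gamma>. x \<in> U}) ` topspace X)"
    using assms by auto
  then show ?thesis by (simp add: cover_ord_def)
qed

lemma cover_dim_leI:
  assumes "finite_open_cover X \<gamma>" "refines \<gamma> \<U>" "topspace X \<noteq> {}"
    and "\<And>x. x \<in> topspace X \<Longrightarrow> card {U \<in> \<gamma>. x \<in> U} \<le> m + 1"
  shows "cover_dim X \<U> \<le> m"
proof -
  have "finite ((\<lambda>x. card {U \<in> \<gamma>. x \<in> U}) ` topspace X)"
    by (rule finite_subset[of _ "{..m + 1}"]) (use assms in auto)
  then have "Max ((\<lambda>x. card {U \<in> \<gamma>. x \<in> U}) ` topspace X) \<le> m + 1"
    using assms by (subst Max_le_iff) auto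
  then have "cover_ord X \<gamma> \<le> m" by (simp add: cover_ord_def)
  moreover have "cover_dim X \<U> \<le> cover_ord X \<gamma>"
    unfolding cover_dim_def by (rule wellorder_Inf_le1) (use assms in auto)
  ultimately show ?thesis by simp
qed

lemma cover_dim_attained:
  assumes "finite_open_cover X \<U>"
  obtains \<gamma> where "finite_open_cover X \<gamma>" "refines \<gamma> \<U>" "cover_ord X \<gamma> = cover_dim X \<U>"
proof -
  let ?S = "{cover_ord X \<gamma> |\<gamma>. finite_open_cover X \<gamma> \<and> refines \<gamma> \<U>}"
  have "refines \<U> \<U>" by (auto simp: refines_def)
  then have "?S \<noteq> {}" using assms by auto
  then have "Inf ?S \<in> ?S" by (rule Inf_nat_def1)
  then show ?thesis using that by (auto simp: cover_dim_def)
qed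

text \<open>The distance to the complement.\<close>

lemma metrizable_space_cozero_function:
  assumes "metrizable_space X" "openin X A"
  shows "\<exists>g. continuous_map X euclideanreal g \<and> (\<forall>x\<in>topspace X. 0 \<le> g x \<and> (0 < g x \<longleftrightarrow> x \<in> A))"
proof (cases "A = topspace X")
  case True
  then show ?thesis by (intro exI[of _ "\<lambda>_. 1"]) auto
next
  case False
  obtain M d where Md: "Metric_space M d" and X: "X = Metric_space.mtopology M d"
    using assms(1) by (auto simp: metrizable_space_def)
  interpret Metric_space M d by fact
  define C where "C = M - A"
  have top: "topspace X = M" using X by simp
  have AM: "A \<subseteq> M" using assms(2) openin_subset top by blast
  have C: "C \<noteq> {}" "C \<subseteq> M" using False AM top by (auto simp: C_def)
  define g where "g x = (INF c\<in>C. d x c)" for x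
  have bdd: "bdd_below (d x ` C)" for x by (rule bdd_belowI[of _ 0]) auto
  have g0: "0 \<le> g x" for x unfolding g_def using C by (intro cINF_greatest) auto
  have gle: "g x \<le> d x c" if "c \<in> C" for x c
    unfolding g_def using bdd that by (intro cINF_lower) auto
  have lip: "g x \<le> g y + d x y" if "x \<in> M" "y \<in> M" for x y
  proof -
    have "g x - d x y \<le> d y c" if "c \<in> C" for c
      using gle[OF that, of x] triangle[of x y c] that C \<open>x \<in> M\<close> \<open>y \<in> M\<close> by fastforce
    then have "g x - d x y \<le> g y"
      unfolding g_def[of y] using C by (intro cINF_greatest) auto
    then show ?thesis by simp
  qed
  have "continuous_map X euclideanreal g"
    unfolding X
  proof (subst metric_continuous_map[OF Met_TC.Metric_space_axioms, unfolded mtopology_is_euclidean, where f=g])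
    show "g ` M \<subseteq> UNIV \<and> (\<forall>a\<in>M. \<forall>\<epsilon>>0. \<exists>\<delta>>0. \<forall>x. x \<in> M \<and> d a x < \<delta> \<longrightarrow> dist (g a) (g x) < \<epsilon>)"
    proof (intro conjI ballI allI impI)
      fix a and \<epsilon> :: real assume a: "a \<in> M" and \<epsilon>: "0 < \<epsilon>"
      have "dist (g a) (g x) \<le> d a x" if "x \<in> M" for x
        using lip[OF a that] lip[OF that a] commute[of a x] by (simp add: dist_real_def abs_le_iff)
      then show "\<exists>\<delta>>0. \<forall>x. x \<in> M \<and> d a x < \<delta> \<longrightarrow> dist (g a) (g x) < \<epsilon>"
        using \<epsilon> by (meson le_less_trans)
    qed auto
  qed
  moreover have "0 < g x \<longleftrightarrow> x \<in> A" if "x \<in> M" for x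
  proof
    assume "0 < g x"
    then show "x \<in> A" using gle[of x x] that by (auto simp: C_def)
  next
    assume "x \<in> A"
    then obtain r where r: "r > 0" "mball x r \<subseteq> A"
      using assms(2) X openin_mtopology by blast
    have "r \<le> d x c" if "c \<in> C" for c
      using r that \<open>x \<in> M\<close> by (force simp: C_def mball_def)
    then have "r \<le> g x" unfolding g_def using C by (intro cINF_greatest) auto
    then show "0 < g x" using r by simp
  qed
  ultimately show ?thesis using g0 top by blast
qed

lemma step_index:
  fixes f :: "nat \<Rightarrow> real"
  assumes "f 0 \<le> t" "t < f r"
  shows "\<exists>i<r. f i \<le> t \<and> t < f (Suc i)"
proof -
  define i where "i = (LEAST i. t < f i)"
  have i: "t < f i" "i \<le> r" unfolding i_def by (rule LeastI[of _ r], fact) (rule Least_le, fact)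
  have "i \<noteq> 0" using i(1) assms(1) by (metis leD)
  then obtain l where l: "i = Suc l" by (cases i) auto
  have "\<not> t < f l" using not_less_Least[of l "\<lambda>i. t < f i"] l by (simp add: i_def)
  then show ?thesis using l i by (intro exI[of _ l]) auto
qed

lemma mono_step_unique:
  fixes f :: "nat \<Rightarrow> real"
  assumes "mono f" "f i \<le> t" "t < f (Suc i)" "f j \<le> t" "t < f (Suc j)"
  shows "i = j"
proof (rule ccontr)
  assume "i \<noteq> j"
  then consider "Suc i \<le> j" | "Suc j \<le> i" by linarith
  then show False using assms by cases (meson leD monoD order_trans)+
qed

text \<open>Two subdivisions of \<open>[0,1]\<close> have a common refinement with fewer intervals than both together: the
  left end of an interval of the refinement determines it and is a left end of one of the two
  subdivisions, and \<open>0\<close> is a left end of both.\<close>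

lemma overlap_count:
  fixes f g :: "nat \<Rightarrow> real" and r s :: nat
  defines "E \<equiv> {(i, j). i < r \<and> j < s \<and> max (f i) (g j) < min (f (Suc i)) (g (Suc j))}"
  assumes f: "mono f" "f 0 = 0" "f r = 1" and g: "mono g" "g 0 = 0" "g s = 1"
  shows "card E + 1 \<le> card {i. i < r \<and> f i < f (Suc i)} + card {j. j < s \<and> g j < g (Suc j)}"
    and "E \<noteq> {}"
proof -
  let ?A = "{i. i < r \<and> f i < f (Suc i)}" and ?B = "{j. j < s \<and> g j < g (Suc j)}"
  obtain i where i: "i < r" "f i \<le> 0" "0 < f (Suc i)" using step_index[of f 0 r] f by auto
  obtain j where j: "j < s" "g j \<le> 0" "0 < g (Suc j)" using step_index[of g 0 s] g by auto
  have "(i, j) \<in> E" using i j by (auto simp: E_def)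
  then show "E \<noteq> {}" by auto
  have i0: "f i = 0" "g j = 0" using i j monoD[OF f(1), of 0 i] monoD[OF g(1), of 0 j] f g by auto
  define e where "e = (\<lambda>(i, j). max (f i) (g j))"
  have inj: "inj_on e E"
  proof (rule inj_onI, clarify)
    fix i j i' j' assume *: "(i, j) \<in> E" "(i', j') \<in> E" "e (i, j) = e (i', j')"
    show "i = i' \<and> j = j'"
      using * mono_step_unique[OF f(1), of i "e (i, j)" i'] mono_step_unique[OF g(1), of j "e (i, j)" j']
      unfolding E_def e_def by (simp add: max_def min_def split: if_splits)
  qed
  have "e ` E \<subseteq> f ` ?A \<union> g ` ?B"
    by (auto simp: E_def e_def max_def)
  then have "card E \<le> card (f ` ?A \<union> g ` ?B)"
    using inj by (intro card_inj_on_le[of e]) auto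
  moreover have "card (f ` ?A \<inter> g ` ?B) \<ge> 1"
  proof -
    have "0 \<in> f ` ?A" by (rule image_eqI[of _ _ i]) (use i i0 in auto)
    moreover have "0 \<in> g ` ?B" by (rule image_eqI[of _ _ j]) (use j i0 in auto)
    ultimately have "0 < card (f ` ?A \<inter> g ` ?B)" by (subst card_gt_0_iff) auto
    then show ?thesis by simp
  qed
  moreover have "card (f ` ?A \<union> g ` ?B) + card (f ` ?A \<inter> g ` ?B) = card (f ` ?A) + card (g ` ?B)"
    by (rule card_Un_Int[symmetric]) auto
  moreover have "card (f ` ?A) \<le> card ?A" "card (g ` ?B) \<le> card ?B"
    by (auto intro: card_image_le)
  ultimately show "card E + 1 \<le> card ?A + card ?B" by linarith
qed

text \<open>The partial sums of a partition of unity subordinate to \<open>\<alpha>\<close> cut \<open>[0,1]\<close> into intervals, continuously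
  in \<open>x\<close>; the \<open>i\<close>-th interval is nondegenerate only if \<open>x\<close> belongs to the \<open>i\<close>-th member.\<close>

lemma cut_functions:
  assumes X: "metrizable_space X" and \<alpha>: "finite_open_cover X \<alpha>"
  obtains r F where "\<And>i. continuous_map X euclideanreal (\<lambda>x. F x i)"
    and "\<And>x. x \<in> topspace X \<Longrightarrow> mono (F x) \<and> F x 0 = 0 \<and> F x r = (1::real) \<and>
      card {i. i < r \<and> F x i < F x (Suc i)} \<le> card {A \<in> \<alpha>. x \<in> A}"
    and "\<And>i. i < r \<Longrightarrow> \<exists>A\<in>\<alpha>. \<forall>x\<in>topspace X. F x i < F x (Suc i) \<longrightarrow> x \<in> A"
proof -
  have fin: "finite \<alpha>" and op: "\<And>A. A \<in> \<alpha> \<Longrightarrow> openin X A" and cov: "\<Union>\<alpha> = topspace X"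
    using \<alpha> by (auto simp: finite_open_cover_def)
  obtain c where c: "bij_betw c {..<card \<alpha>} \<alpha>"
    using ex_bij_betw_nat_finite[OF fin] by (auto simp: atLeast0LessThan)
  define r where "r = card \<alpha>"
  have cA: "c i \<in> \<alpha>" if "i < r" for i using c that by (auto simp: r_def bij_betw_def)
  have "\<forall>A\<in>\<alpha>. \<exists>g. continuous_map X euclideanreal g \<and> (\<forall>x\<in>topspace X. 0 \<le> g x \<and> (0 < g x \<longleftrightarrow> x \<in> A))"
    using metrizable_space_cozero_function[OF X] op by auto
  then obtain g where g: "\<And>A. A \<in> \<alpha> \<Longrightarrow> continuous_map X euclideanreal (g A)"
    "\<And>A x. A \<in> \<alpha> \<Longrightarrow> x \<in> topspace X \<Longrightarrow> 0 \<le> g A x \<and> (0 < g A x \<longleftrightarrow> x \<in> A)"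
    by metis
  define \<phi> where "\<phi> i x = (if i < r then g (c i) x else 0)" for i x
  define S where "S x = (\<Sum>i<r. \<phi> i x)" for x
  define F where "F x i = (\<Sum>l<i. \<phi> l x) / S x" for x i
  have \<phi>0: "0 \<le> \<phi> i x" if "x \<in> topspace X" for i x
    using g(2) cA that by (auto simp: \<phi>_def)
  have S0: "0 < S x" if "x \<in> topspace X" for x
  proof -
    obtain A where "A \<in> \<alpha>" "x \<in> A" using cov \<open>x \<in> topspace X\<close> by auto
    then obtain i where i: "i < r" "c i = A"
      using bij_betw_imp_surj_on[OF c] by (metis imageE lessThan_iff r_def)
    then have "0 < \<phi> i x" using g(2) \<open>A \<in> \<alpha>\<close> \<open>x \<in> A\<close> that by (auto simp: \<phi>_def)
    then show ?thesis
      unfolding S_def using i \<phi>0[OF that] by (intro sum_pos2[of _ i]) auto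
  qed
  have c\<phi>: "continuous_map X euclideanreal (\<phi> i)" for i
    using g(1) cA by (cases "i < r") (auto simp: \<phi>_def[abs_def])
  have step: "F x i < F x (Suc i) \<longleftrightarrow> 0 < \<phi> i x" if "x \<in> topspace X" for x i
    using S0[OF that] by (simp add: F_def divide_less_cancel)
  show thesis
  proof (rule that[of F r]; (intro conjI)?)
    show "continuous_map X euclideanreal (\<lambda>x. F x i)" for i
      unfolding F_def S_def
      by (intro continuous_map_real_divide continuous_map_sum c\<phi>) (use S0 S_def in \<open>force+\<close>)
    fix x assume x: "x \<in> topspace X"
    show "mono (F x)"
      using S0[OF x] \<phi>0[OF x] by (intro mono_iff_le_Suc[THEN iffD2]) (auto simp: F_def divide_right_mono)
    show "F x 0 = 0" by (simp add: F_def)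
    show "F x r = 1" using S0[OF x] by (simp add: F_def S_def)
    have "c ` {i. i < r \<and> F x i < F x (Suc i)} \<subseteq> {A \<in> \<alpha>. x \<in> A}"
      using step[OF x] cA g(2) x by (auto simp: \<phi>_def)
    moreover have "inj_on c {i. i < r \<and> F x i < F x (Suc i)}"
      using c by (auto simp: bij_betw_def r_def intro: inj_on_subset)
    ultimately show "card {i. i < r \<and> F x i < F x (Suc i)} \<le> card {A \<in> \<alpha>. x \<in> A}"
      using fin by (metis (no_types, lifting) card_image card_mono finite_Collect_conjI mem_Collect_eq rev_finite_subset subsetI)
  next
    fix i assume "i < r"
    then show "\<exists>A\<in>\<alpha>. \<forall>x\<in>topspace X. F x i < F x (Suc i) \<longrightarrow> x \<in> A"
      using step cA g(2) by (intro bexI[of _ "c i"]) (auto simp: \<phi>_def)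
  qed
qed

text \<open>The simplices spanned by the members of \<open>\<alpha>\<close> and of \<open>\<beta>\<close> at \<open>x\<close> have a product whose standard
  triangulation has dimension the sum of both.  In coordinates: cut \<open>[0,1]\<close> by the partial sums of
  both partitions of unity, and let the \<open>(i,j)\<close>-th set consist of the points at which the \<open>i\<close>-th
  interval of the one overlaps the \<open>j\<close>-th interval of the other.  These sets refine \<open>\<alpha>\<close> and \<open>\<beta>\<close>, and
  counting the overlaps bounds their order by the sum of the orders.\<close>

lemma cover_dim_join_le:
  assumes X: "metrizable_space X" and ne: "topspace X \<noteq> {}"
    and U: "finite_open_cover X \<U>" and V: "finite_open_cover X \<V>"
    and W: "\<And>A B. A \<in> \<U> \<Longrightarrow> B \<in> \<V> \<Longrightarrow> \<exists>C\<in>\<W>. A \<inter> B \<subseteq> C"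
  shows "cover_dim X \<W> \<le> cover_dim X \<U> + cover_dim X \<V>"
proof -
  obtain \<alpha> where \<alpha>: "finite_open_cover X \<alpha>" "refines \<alpha> \<U>" "cover_ord X \<alpha> = cover_dim X \<U>"
    using cover_dim_attained[OF U] by blast
  obtain \<beta> where \<beta>: "finite_open_cover X \<beta>" "refines \<beta> \<V>" "cover_ord X \<beta> = cover_dim X \<V>"
    using cover_dim_attained[OF V] by blast
  obtain r F where F: "\<And>i. continuous_map X euclideanreal (\<lambda>x. F x i)"
    "\<And>x. x\<in>topspace X \<Longrightarrow> mono (F x) \<and> F x 0 = 0 \<and> F x r = 1 \<and>
      card {i. i < r \<and> F x i < F x (Suc i)} \<le> card {A \<in> \<alpha>. x \<in> A}"
    "\<And>i. i < r \<Longrightarrow> \<exists>A\<in>\<alpha>. \<forall>x\<in>topspace X. F x i < F x (Suc i) \<longrightarrow> x \<in> A"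
    by (rule cut_functions[OF X \<alpha>(1)]) blast
  obtain s G where G: "\<And>i. continuous_map X euclideanreal (\<lambda>x. G x i)"
    "\<And>x. x\<in>topspace X \<Longrightarrow> mono (G x) \<and> G x 0 = 0 \<and> G x s = 1 \<and>
      card {i. i < s \<and> G x i < G x (Suc i)} \<le> card {A \<in> \<beta>. x \<in> A}"
    "\<And>i. i < s \<Longrightarrow> \<exists>A\<in>\<beta>. \<forall>x\<in>topspace X. G x i < G x (Suc i) \<longrightarrow> x \<in> A"
    by (rule cut_functions[OF X \<beta>(1)]) blast
  define O' where "O' = (\<lambda>(i, j). {x \<in> topspace X. max (F x i) (G x j) < min (F x (Suc i)) (G x (Suc j))})"
  define E where "E x = {(i, j). i < r \<and> j < s \<and> max (F x i) (G x j) < min (F x (Suc i)) (G x (Suc j))}" for x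
  define \<gamma> where "\<gamma> = O' ` ({..<r} \<times> {..<s})"
  have fin: "finite \<alpha>" "finite \<beta>" using \<alpha> \<beta> by (auto simp: finite_open_cover_def)
  show ?thesis
  proof (rule cover_dim_leI[OF _ _ ne])
    have "openin X (O' (i, j))" for i j
    proof -
      have "O' (i, j) = {x \<in> topspace X. min (F x (Suc i)) (G x (Suc j)) - max (F x i) (G x j) \<in> {0<..}}"
        by (auto simp: O'_def)
      then show ?thesis
        using openin_continuous_map_preimage[of X euclideanreal "\<lambda>x. min (F x (Suc i)) (G x (Suc j)) - max (F x i) (G x j)" "{0<..}"]
        by (simp add: continuous_map_diff continuous_map_real_min continuous_map_real_max F(1) G(1))
    qed
    moreover have "\<Union>\<gamma> = topspace X"
    proof
      show "\<Union>\<gamma> \<subseteq> topspace X" by (auto simp: \<gamma>_def O'_def)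
      show "topspace X \<subseteq> \<Union>\<gamma>"
      proof
        fix x assume x: "x \<in> topspace X"
        have "E x \<noteq> {}" unfolding E_def using overlap_count(2)[of "F x" r "G x" s] F(2)[OF x] G(2)[OF x] by blast
        then show "x \<in> \<Union>\<gamma>" using x by (auto simp: E_def \<gamma>_def O'_def)
      qed
    qed
    ultimately show "finite_open_cover X \<gamma>"
      by (auto simp: finite_open_cover_def \<gamma>_def)
    show "refines \<gamma> \<W>"
      unfolding refines_def
    proof
      fix Q assume "Q \<in> \<gamma>"
      then obtain i j where ij: "i < r" "j < s" "Q = O' (i, j)" by (auto simp: \<gamma>_def)
      obtain A where A: "A \<in> \<alpha>" "\<forall>x\<in>topspace X. F x i < F x (Suc i) \<longrightarrow> x \<in> A" using F(3)[OF ij(1)] by blast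
      obtain B where B: "B \<in> \<beta>" "\<forall>x\<in>topspace X. G x j < G x (Suc j) \<longrightarrow> x \<in> B" using G(3)[OF ij(2)] by blast
      obtain A' B' where AB: "A' \<in> \<U>" "A \<subseteq> A'" "B' \<in> \<V>" "B \<subseteq> B'"
        using \<alpha>(2) \<beta>(2) A B by (meson refines_def)
      obtain C where C: "C \<in> \<W>" "A' \<inter> B' \<subseteq> C" using W AB by blast
      have "Q \<subseteq> A \<inter> B" using A B ij by (auto simp: O'_def)
      then show "\<exists>C\<in>\<W>. Q \<subseteq> C" using AB C by blast
    qed
    fix x assume x: "x \<in> topspace X"
    have fE: "finite (E x)" by (rule finite_subset[of _ "{..<r} \<times> {..<s}"]) (auto simp: E_def)
    have "{Q \<in> \<gamma>. x \<in> Q} \<subseteq> O' ` E x" by (auto simp: \<gamma>_def E_def O'_def)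
    then have "card {Q \<in> \<gamma>. x \<in> Q} \<le> card (E x)"
      by (rule surj_card_le[OF fE])
    moreover have "card (E x) + 1 \<le> card {A \<in> \<alpha>. x \<in> A} + card {A \<in> \<beta>. x \<in> A}"
      unfolding E_def using overlap_count(1)[of "F x" r "G x" s] F(2)[OF x] G(2)[OF x] by linarith
    ultimately show "card {Q \<in> \<gamma>. x \<in> Q} \<le> cover_dim X \<U> + cover_dim X \<V> + 1"
      using card_le_cover_ord[OF fin(1) x] card_le_cover_ord[OF fin(2) x] \<alpha>(3) \<beta>(3) by linarith
  qed
qed

lemma cover_dim_pullback_le:
  assumes ne: "topspace X \<noteq> {}" and h: "continuous_map X Y h" and V: "finite_open_cover Y \<V>"
    and W: "\<And>B. B \<in> \<V> \<Longrightarrow> \<exists>C\<in>\<W>. {x \<in> topspace X. h x \<in> B} \<subseteq> C"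
  shows "cover_dim X \<W> \<le> cover_dim Y \<V>"
proof -
  obtain \<beta> where \<beta>: "finite_open_cover Y \<beta>" "refines \<beta> \<V>" "cover_ord Y \<beta> = cover_dim Y \<V>"
    using cover_dim_attained[OF V] by blast
  have fin: "finite \<beta>" using \<beta> by (auto simp: finite_open_cover_def)
  define pb where "pb B = {x \<in> topspace X. h x \<in> B}" for B
  show ?thesis
  proof (rule cover_dim_leI[OF _ _ ne])
    have "h x \<in> topspace Y" if "x \<in> topspace X" for x
      using h that by (auto simp: continuous_map_def)
    moreover have "openin X (pb B)" if "B \<in> \<beta>" for B
      unfolding pb_def using h \<beta>(1) that by (auto simp: finite_open_cover_def intro!: openin_continuous_map_preimage)
    ultimately show "finite_open_cover X (pb ` \<beta>)"
      using \<beta>(1) by (fastforce simp: finite_open_cover_def pb_def)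
    show "refines (pb ` \<beta>) \<W>"
      unfolding refines_def
    proof clarify
      fix B assume "B \<in> \<beta>"
      then obtain B' where B': "B' \<in> \<V>" "B \<subseteq> B'" using \<beta>(2) by (meson refines_def)
      then obtain C where "C \<in> \<W>" "pb B' \<subseteq> C" using W unfolding pb_def by blast
      moreover have "pb B \<subseteq> pb B'" using B' by (auto simp: pb_def)
      ultimately show "\<exists>C\<in>\<W>. pb B \<subseteq> C" by blast
    qed
    fix x assume x: "x \<in> topspace X"
    then have hx: "h x \<in> topspace Y" using h by (auto simp: continuous_map_def)
    have "{Q \<in> pb ` \<beta>. x \<in> Q} \<subseteq> pb ` {B \<in> \<beta>. h x \<in> B}" by (auto simp: pb_def)
    then have "card {Q \<in> pb ` \<beta>. x \<in> Q} \<le> card {B \<in> \<beta>. h x \<in> B}"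
      using fin by (intro surj_card_le[where f = pb]) auto
    then show "card {Q \<in> pb ` \<beta>. x \<in> Q} \<le> cover_dim Y \<V> + 1"
      using card_le_cover_ord[OF fin hx] \<beta>(3) by linarith
  qed
qed

lemma continuous_map_funpow:
  "continuous_map X X T \<Longrightarrow> continuous_map X X (T ^^ n)"
  by (induction n) (auto simp: id_def intro: continuous_map_compose)

lemma finite_open_cover_iterated:
  assumes T: "continuous_map X X T" and U: "finite_open_cover X \<U>"
  shows "finite_open_cover X (iterated_cover X T \<U> n)"
proof -
  let ?I = "\<lambda>f. topspace X \<inter> (\<Inter>i<n. (T ^^ i) -` f i)"
  have "iterated_cover X T \<U> n = ?I ` PiE {..<n} (\<lambda>_. \<U>)"
  proof (intro equalityI subsetI)
    fix A assume "A \<in> iterated_cover X T \<U> n"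
    then obtain f where f: "A = ?I f" "\<forall>i<n. f i \<in> \<U>" by (auto simp: iterated_cover_def)
    then have "A = ?I (restrict f {..<n})" by auto
    then show "A \<in> ?I ` PiE {..<n} (\<lambda>_. \<U>)" using f by (intro image_eqI[of _ _ "restrict f {..<n}"]) auto
  next
    fix A assume "A \<in> ?I ` PiE {..<n} (\<lambda>_. \<U>)"
    then obtain f where "A = ?I f" "f \<in> PiE {..<n} (\<lambda>_. \<U>)" by blast
    then show "A \<in> iterated_cover X T \<U> n" unfolding iterated_cover_def by (auto simp: PiE_iff)
  qed
  then have "finite (iterated_cover X T \<U> n)"
    using U by (auto simp: finite_open_cover_def intro!: finite_PiE)
  moreover have "openin X (?I f)" if "\<forall>i<n. f i \<in> \<U>" for f
  proof -
    have "?I f = (\<Inter>i<n. {x \<in> topspace X. (T ^^ i) x \<in> f i}) \<inter> topspace X" by auto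
    moreover have "openin X {x \<in> topspace X. (T ^^ i) x \<in> f i}" if "i < n" for i
      using continuous_map_funpow[OF T, of i] U \<open>\<forall>i<n. f i \<in> \<U>\<close> that
      by (auto simp: finite_open_cover_def intro!: openin_continuous_map_preimage)
    ultimately show ?thesis by (cases "n = 0") (auto intro!: openin_INT)
  qed
  moreover have "\<exists>A \<in> iterated_cover X T \<U> n. x \<in> A" if x: "x \<in> topspace X" for x
  proof -
    have "\<exists>A\<in>\<U>. (T ^^ i) x \<in> A" for i
      using continuous_map_funpow[OF T, of i] U x by (auto simp: finite_open_cover_def continuous_map_def)
    then obtain f where "\<And>i. f i \<in> \<U> \<and> (T ^^ i) x \<in> f i" by metis
    then show ?thesis using x unfolding iterated_cover_def by (intro bexI[of _ "?I f"]) auto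
  qed
  ultimately show ?thesis
    by (fastforce simp: finite_open_cover_def iterated_cover_def)
qed

lemma cover_dim_iterated_subadditive:
  assumes X: "metrizable_space X" and ne: "topspace X \<noteq> {}"
    and T: "continuous_map X X T" and U: "finite_open_cover X \<U>"
  shows "cover_dim X (iterated_cover X T \<U> (m + n))
    \<le> cover_dim X (iterated_cover X T \<U> m) + cover_dim X (iterated_cover X T \<U> n)"
proof -
  define pb where "pb B = {x \<in> topspace X. (T ^^ m) x \<in> B}" for B
  let ?P = "pb ` iterated_cover X T \<U> n"
  note Tm = continuous_map_funpow[OF T, of m]
  have foc: "finite_open_cover X (iterated_cover X T \<U> n)" for n
    by (rule finite_open_cover_iterated[OF T U])
  have P: "finite_open_cover X ?P"
  proof -
    have "(T ^^ m) x \<in> topspace X" if "x \<in> topspace X" for x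
      using Tm that by (auto simp: continuous_map_def)
    moreover have "openin X (pb B)" if "B \<in> iterated_cover X T \<U> n" for B
      unfolding pb_def using Tm foc that by (auto simp: finite_open_cover_def intro!: openin_continuous_map_preimage)
    ultimately show ?thesis using foc[of n] by (fastforce simp: finite_open_cover_def pb_def)
  qed
  have "cover_dim X (iterated_cover X T \<U> (m + n)) \<le> cover_dim X (iterated_cover X T \<U> m) + cover_dim X ?P"
  proof (rule cover_dim_join_le[OF X ne foc P])
    fix A B assume "A \<in> iterated_cover X T \<U> m" "B \<in> ?P"
    then obtain f g where f: "A = topspace X \<inter> (\<Inter>i<m. (T ^^ i) -` f i)" "\<forall>i<m. f i \<in> \<U>"
      and g: "B = pb (topspace X \<inter> (\<Inter>i<n. (T ^^ i) -` g i))" "\<forall>i<n. g i \<in> \<U>"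
      by (auto simp: iterated_cover_def)
    define h where "h i = (if i < m then f i else g (i - m))" for i
    have "A \<inter> B \<subseteq> topspace X \<inter> (\<Inter>i<m+n. (T ^^ i) -` h i)"
    proof
      fix x assume x: "x \<in> A \<inter> B"
      have "(T ^^ i) x \<in> h i" if i: "i < m + n" for i
      proof (cases "i < m")
        case True
        then show ?thesis using x f by (auto simp: h_def)
      next
        case False
        have "(T ^^ (i - m)) ((T ^^ m) x) \<in> g (i - m)" using x g i False by (auto simp: pb_def)
        moreover have "(T ^^ (i - m)) ((T ^^ m) x) = (T ^^ i) x"
          using False by (metis comp_apply funpow_add le_add_diff_inverse2 not_less)
        ultimately show ?thesis using False by (simp add: h_def)
      qed
      then show "x \<in> topspace X \<inter> (\<Inter>i<m+n. (T ^^ i) -` h i)" using x f by auto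
    qed
    moreover have "topspace X \<inter> (\<Inter>i<m+n. (T ^^ i) -` h i) \<in> iterated_cover X T \<U> (m + n)"
      unfolding iterated_cover_def using f g by (auto simp: h_def)
    ultimately show "\<exists>C\<in>iterated_cover X T \<U> (m + n). A \<inter> B \<subseteq> C" by blast
  qed
  also have "cover_dim X ?P \<le> cover_dim X (iterated_cover X T \<U> n)"
    by (rule cover_dim_pullback_le[OF ne Tm foc]) (auto simp: pb_def)
  finally show ?thesis by simp
qed

text \<open>Fekete's lemma: the limit is the infimum \<open>L\<close> of \<open>u n / n\<close>.\<close>

lemma Fekete:
  fixes u :: "nat \<Rightarrow> nat"
  assumes sub: "\<And>m n. u (m + n) \<le> u m + u n"
  shows "convergent (\<lambda>n. real (u n) / real n)"
proof -
  define L where "L = (INF n\<in>{1..}. real (u n) / real n)"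
  have bdd: "bdd_below ((\<lambda>n. real (u n) / real n) ` {1..})" by (rule bdd_belowI[of _ 0]) auto
  have L: "L \<le> real (u n) / real n" if "n \<ge> 1" for n
    unfolding L_def using bdd that by (intro cINF_lower) auto
  have mult: "u (q * m + r) \<le> q * u m + u r" for q m r
    by (induction q) (auto simp: add.assoc intro: order_trans[OF sub])
  have "(\<lambda>n. real (u n) / real n) \<longlonglongrightarrow> L"
  proof (rule LIMSEQ_I)
    fix e :: real assume e: "0 < e"
    have "\<exists>m\<in>{1..}. real (u m) / real m < L + e / 2"
      using cINF_less_iff[OF _ bdd, of "L + e / 2"] e by (auto simp: L_def)
    then obtain m where m: "m \<ge> 1" "real (u m) / real m < L + e / 2" by auto
    define M where "M = Max (u ` {..<m})"
    obtain N :: nat where N: "2 * real M / e < real N" using reals_Archimedean2 by blast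
    have "norm (real (u n) / real n - L) < e" if n: "n \<ge> max N 1" for n
    proof -
      have "u (n mod m) \<le> M" unfolding M_def using m by (intro Max_ge) auto
      then have "u n \<le> (n div m) * u m + M" using mult[of "n div m" m "n mod m"] by (simp add: mult.commute)
      then have "real (u n) \<le> real (n div m) * real (u m) + real M"
        by (metis of_nat_add of_nat_le_iff of_nat_mult)
      also have "real (n div m) * real (u m) \<le> real n / real m * real (u m)"
        by (intro mult_right_mono) (auto simp: of_nat_div_le_of_nat)
      finally have "real (u n) / real n \<le> (real n / real m * real (u m) + real M) / real n"
        using n by (intro divide_right_mono) auto
      also have "\<dots> = real (u m) / real m + real M / real n"
        using n m by (simp add: field_simps)
      also have "real M / real n < e / 2"
      proof -
        have "2 * real M / e < real n" using N n by simp
        then show ?thesis using e n by (simp add: field_simps)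
      qed
      finally show ?thesis using m(2) L[of n] n by simp
    qed
    then show "\<exists>no. \<forall>n\<ge>no. norm (real (u n) / real n - L) < e" by blast
  qed
  then show ?thesis by (auto simp: convergent_def)
qed

text \<open>By subadditivity the sequence has a limit, so that \<^const>\<open>mdim_cover\<close>, defined by \<^const>\<open>lim\<close>, is
  meaningful.\<close>

lemma mdim_cover_LIMSEQ:
  assumes "metrizable_space X" "topspace X \<noteq> {}" "continuous_map X X T" "finite_open_cover X \<U>"
  shows "(\<lambda>n. real (cover_dim X (iterated_cover X T \<U> n)) / real n) \<longlonglongrightarrow> mdim_cover X T \<U>"
  unfolding mdim_cover_def
  using Fekete[OF cover_dim_iterated_subadditive[OF assms]] by (simp add: convergent_LIMSEQ_iff)

section \<open>Rotations of the torus, codings and the hub-and-spoke system\<close>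

lemma torus_proj_eq_iff: "torus_proj x = torus_proj y \<longleftrightarrow> (\<forall>i. x $ i - y $ i \<in> \<int>)"
  using torus.abs_eq_iff by blast

lemma torus_proj_surj: "\<exists>x. v = torus_proj x"
  by (rule exI[of _ "torus_rep v"]) (rule Quotient3_abs_rep[OF Quotient3_torus, symmetric])

lemma rotation_proj [simp]: "rotation b (torus_proj x) = torus_proj (x + b)"
  by (rule rotation.abs_eq)

lemma rotation_rotation [simp]: "rotation b (rotation c v) = rotation (b + c) v"
proof -
  obtain x where "v = torus_proj x" using torus_proj_surj by blast
  then show ?thesis by (simp add: ac_simps)
qed

lemma rotation_0 [simp]: "rotation 0 v = v"
proof -
  obtain x where "v = torus_proj x" using torus_proj_surj by blast
  then show ?thesis by simp
qed

lemma inv_rotation: "inv (rotation b) = rotation (- b)"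
  by (rule inv_unique_comp) (auto simp: fun_eq_iff)

lemma rotation_funpow: "(rotation b ^^ n) v = rotation (real n *\<^sub>R b) v"
  by (induction n) (auto simp: algebra_simps)

lemma int_iterate_rotation: "int_iterate (rotation b) m v = rotation (of_int m *\<^sub>R b) v"
  by (auto simp: int_iterate_def inv_rotation rotation_funpow)

lemma open_torus_iff: "open S \<longleftrightarrow> open (torus_proj -` S)"
  by (rule open_torus_def)

lemma open_torus_proj_image:
  assumes "open S"
  shows "open (torus_proj ` S)"
proof -
  have "torus_proj -` torus_proj ` S = (\<Union>n\<in>{n. \<forall>i. n $ i \<in> \<int>}. (\<lambda>x. x + n) ` S)" (is "?L = ?R")
  proof
    show "?L \<subseteq> ?R"
    proof
      fix x assume "x \<in> ?L"
      then obtain y where y: "y \<in> S" "torus_proj x = torus_proj y" by blast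
      then have "\<forall>i. (x - y) $ i \<in> \<int>" by (simp add: torus_proj_eq_iff)
      moreover have "x = y + (x - y)" by simp
      ultimately show "x \<in> ?R" using y(1) by blast
    qed
    show "?R \<subseteq> ?L"
    proof
      fix x assume "x \<in> ?R"
      then obtain n y where "\<forall>i. n $ i \<in> \<int>" "y \<in> S" "x = y + n" by blast
      then have "torus_proj x = torus_proj y" by (simp add: torus_proj_eq_iff)
      with \<open>y \<in> S\<close> show "x \<in> ?L" by simp
    qed
  qed
  moreover have "open ((\<lambda>x. x + n) ` S)" for n
    using open_translation[OF assms, of n] by (simp add: add.commute)
  ultimately show ?thesis by (simp add: open_torus_iff open_UN)
qed

lemma open_vimage_rotation:
  assumes "open S"
  shows "open (rotation b -` S)"
proof -
  have "open (torus_proj -` S)" using assms by (simp add: open_torus_iff)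
  then have "open ((\<lambda>x. x + b) -` (torus_proj -` S))"
    by (rule open_vimage) (intro continuous_intros)
  moreover have "(\<lambda>x. x + b) -` (torus_proj -` S) = torus_proj -` (rotation b -` S)" by auto
  ultimately show ?thesis by (simp add: open_torus_iff)
qed

text \<open>A basic open set of the product topology constrains finitely many coordinates only.\<close>

lemma open_fun_agree:
  fixes V :: "('i \<Rightarrow> 'b::topological_space) set"
  assumes "open V" "x \<in> V"
  shows "\<exists>F. finite F \<and> (\<forall>y. (\<forall>m\<in>F. y m = x m) \<longrightarrow> y \<in> V)"
proof -
  have "openin (product_topology (\<lambda>i. euclidean) UNIV) V"
    using assms by (simp add: open_fun_def)
  from product_topology_open_contains_basis[OF this assms(2)]
  obtain X where X: "x \<in> (\<Pi>\<^sub>E i\<in>UNIV. X i)" "finite {i. X i \<noteq> UNIV}" "(\<Pi>\<^sub>E i\<in>UNIV. X i) \<subseteq> V"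
    by auto
  show ?thesis
  proof (intro exI conjI allI impI)
    show "finite {i. X i \<noteq> UNIV}" by fact
    fix y assume "\<forall>m\<in>{i. X i \<noteq> UNIV}. y m = x m"
    then have "y \<in> (\<Pi>\<^sub>E i\<in>UNIV. X i)" using X(1) by (auto simp: PiE_iff) (metis UNIV_I)
    then show "y \<in> V" using X by auto
  qed
qed

lemma continuous_coordinate: "continuous_on S (\<lambda>x::'i \<Rightarrow> 'b::topological_space. x i)"
  by (rule continuous_on_subset[OF continuous_on_product_coordinates]) simp

lemma in_closure_discrete_fun_iff:
  fixes S :: "('i \<Rightarrow> 'b::discrete_topology) set"
  shows "y \<in> closure S \<longleftrightarrow> (\<forall>F. finite F \<longrightarrow> (\<exists>x\<in>S. \<forall>m\<in>F. x m = y m))"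
proof safe
  fix F :: "'i set" assume y: "y \<in> closure S" and F: "finite F"
  have "open (\<Inter>m\<in>F. (\<lambda>x. x m) -` {y m})"
    using F by (intro open_INT ballI open_vimage continuous_coordinate) (auto simp: open_discrete)
  with y show "\<exists>x\<in>S. \<forall>m\<in>F. x m = y m"
    using closure_iff_nhds_not_empty[of y S] by (force dest: spec[where x="\<Inter>m\<in>F. (\<lambda>x. x m) -` {y m}"])
next
  assume *: "\<forall>F. finite F \<longrightarrow> (\<exists>x\<in>S. \<forall>m\<in>F. x m = y m)"
  show "y \<in> closure S"
    unfolding closure_iff_nhds_not_empty
  proof safe
    fix A V assume "V \<subseteq> A" "open V" "y \<in> V" "S \<inter> A = {}"
    then obtain F where F: "finite F" "\<And>x. (\<forall>m\<in>F. x m = y m) \<Longrightarrow> x \<in> V"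
      using open_fun_agree by metis
    then obtain x where "x \<in> S" "x \<in> V" using * by meson
    with \<open>V \<subseteq> A\<close> \<open>S \<inter> A = {}\<close> show False by auto
  qed
qed

definition \<Phi> :: "(nat \<Rightarrow> real ^ 2) \<Rightarrow> (int \<Rightarrow> nat) \<Rightarrow> (int \<Rightarrow> real) \<Rightarrow> int \<Rightarrow> real ^ 2" where
  "\<Phi> p y \<rho> m = \<rho> m *\<^sub>R p (y m)"

lemma Spoke_altdef: "Spoke p Y = {\<Phi> p y \<rho> |y \<rho>. y \<in> Y \<and> (\<forall>m. \<rho> m \<in> {0..1})}"
  by (auto simp: Spoke_def \<Phi>_def[abs_def])

locale rotation_coding =
  fixes a :: "real ^ 'd::finite"
    and k :: nat
    and U :: "nat \<Rightarrow> 'd torus set"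
    and P' :: "nat \<Rightarrow> (real ^ 'd) set"
    and p :: "nat \<Rightarrow> real ^ 2"
  assumes k2: "k \<ge> 2"
    and indep: "rationally_independent_with_one a"
    and U_open: "\<And>i. i \<in> {1..k} \<Longrightarrow> open (U i) \<and> U i \<noteq> {}"
    and U_disj: "\<And>i j. i \<in> {1..k} \<Longrightarrow> j \<in> {1..k} \<Longrightarrow> i \<noteq> j \<Longrightarrow> U i \<inter> U j = {}"
    and U_cover: "(\<Union>i\<in>{1..k}. closure (U i)) = UNIV"
    and U_regular: "\<And>i. i \<in> {1..k} \<Longrightarrow> U i = interior (closure (U i))"
    and P': "\<And>i. i \<in> {1..k} \<Longrightarrow> compact (P' i) \<and> convex (P' i) \<and>
           torus_proj ` P' i = closure (U i) \<and> diameter (P' i) < 1 / 2"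
    and p_inj: "inj_on p {1..k}"
    and p_sphere: "\<And>i. i \<in> {1..k} \<Longrightarrow> p i \<in> sphere 0 1"
begin

abbreviation R :: "int \<Rightarrow> 'd torus \<Rightarrow> 'd torus" where "R m \<equiv> rotation (of_int m *\<^sub>R a)"
abbreviation reg where "reg \<equiv> regular_points a k U"
abbreviation cod where "cod \<equiv> coding a k U"
abbreviation Y where "Y \<equiv> coding_system a k U"
abbreviation Z where "Z \<equiv> Spoke p Y"

lemma frontier_U: "i \<in> {1..k} \<Longrightarrow> frontier (closure (U i)) = closure (U i) - U i"
  by (metis U_regular closure_closure frontier_def)

lemma reg_iff: "v \<in> reg \<longleftrightarrow> (\<forall>m. \<forall>i\<in>{1..k}. R m v \<notin> closure (U i) - U i)"
  by (auto simp: regular_points_def int_iterate_rotation frontier_U)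

lemma reg_in_U: "v \<in> reg \<Longrightarrow> i \<in> {1..k} \<Longrightarrow> R m v \<in> closure (U i) \<longleftrightarrow> R m v \<in> U i"
  using closure_subset by (fastforce simp: reg_iff)

lemma reg_ex1: "v \<in> reg \<Longrightarrow> \<exists>!i. i \<in> {1..k} \<and> R m v \<in> U i"
proof -
  assume v: "v \<in> reg"
  obtain i where "i \<in> {1..k}" "R m v \<in> closure (U i)" using U_cover by blast
  then have i: "i \<in> {1..k}" "R m v \<in> U i" using reg_in_U[OF v] by auto
  show ?thesis
  proof (rule ex1I[of _ i])
    fix j assume "j \<in> {1..k} \<and> R m v \<in> U j"
    then show "j = i" using U_disj[of i j] i by auto
  qed (use i in auto)
qed

lemma cod_in: "v \<in> reg \<Longrightarrow> cod v m \<in> {1..k} \<and> R m v \<in> U (cod v m)"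
  unfolding coding_def int_iterate_rotation by (rule theI'[OF reg_ex1])

lemma cod_iff: "v \<in> reg \<Longrightarrow> i \<in> {1..k} \<Longrightarrow> cod v m = i \<longleftrightarrow> R m v \<in> U i"
  using cod_in reg_ex1 by blast

lemma R_R [simp]: "R m (R n v) = R (m + n) v"
  by (simp add: scaleR_add_left)

lemma reg_R: "v \<in> reg \<Longrightarrow> R m v \<in> reg"
  unfolding reg_iff by (simp flip: scaleR_add_left of_int_add)

lemma cod_R: "v \<in> reg \<Longrightarrow> cod (R m v) n = cod v (n + m)"
  using cod_in[of v "n + m"] reg_R[of v m] by (simp add: cod_iff flip: scaleR_add_left of_int_add)

text \<open>Baire's theorem, applied to the lifts to \<open>\<real>\<^sup>d\<close>: the boundary of each piece is closed with empty
  interior because the pieces are regular open sets.\<close>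

lemma reg_dense:
  assumes "open G" "G \<noteq> {}"
  shows "\<exists>v\<in>G. v \<in> reg"
proof -
  define N where "N = (\<lambda>(m, i). {x. R m (torus_proj x) \<notin> closure (U i) - U i})"
  have "UNIV \<subseteq> closure (\<Inter>(N ` (UNIV \<times> {1..k})))"
  proof (rule Baire)
    fix T assume "T \<in> N ` (UNIV \<times> {1..k})"
    then obtain m i where i: "i \<in> {1..k}" and T: "T = N (m, i)" by auto
    have "closed (closure (U i) - U i)" using U_open i by (intro closed_Diff) auto
    then have "open (R m -` (- (closure (U i) - U i)))" by (intro open_vimage_rotation open_Compl)
    moreover have "T = torus_proj -` (R m -` (- (closure (U i) - U i)))" by (auto simp: T N_def)
    ultimately have oT: "open T" unfolding open_torus_iff by simp
    have "x \<in> closure T" for x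
      unfolding closure_iff_nhds_not_empty
    proof safe
      fix A V assume V: "V \<subseteq> A" "open V" "x \<in> V" "T \<inter> A = {}"
      define W where "W = (\<lambda>x. x + of_int m *\<^sub>R a) ` V"
      have "open W" unfolding W_def using V(2) open_translation[of V "of_int m *\<^sub>R a"] by (simp add: add.commute)
      then have "open (torus_proj ` W)" by (rule open_torus_proj_image)
      moreover have *: "torus_proj ` W \<subseteq> closure (U i) - U i"
        using V by (auto simp: T N_def W_def)
      ultimately have "torus_proj ` W \<subseteq> interior (closure (U i))" by (intro interior_maximal) auto
      with * U_regular[OF i] have "torus_proj ` W = {}" by blast
      then show False using V by (auto simp: W_def)
    qed
    then show "openin (top_of_set UNIV) T \<and> UNIV \<subseteq> closure T" using oT by auto
  qed auto
  moreover have "open (torus_proj -` G)" using assms open_torus_iff by auto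
  moreover obtain x where "x \<in> torus_proj -` G" using assms torus_proj_surj by (metis ex_in_conv vimageI)
  ultimately have "\<Inter>(N ` (UNIV \<times> {1..k})) \<inter> (torus_proj -` G) \<noteq> {}"
    using closure_iff_nhds_not_empty by (metis UNIV_I order_refl subsetD)
  then show ?thesis by (fastforce simp: N_def reg_iff)
qed

lemma Y_iff: "y \<in> Y \<longleftrightarrow> (\<forall>F. finite F \<longrightarrow> (\<exists>v\<in>reg. \<forall>m\<in>F. cod v m = y m))"
  by (simp add: coding_system_def in_closure_discrete_fun_iff)

lemma cod_in_Y: "v \<in> reg \<Longrightarrow> cod v \<in> Y"
  by (auto simp: Y_iff)

lemma Y_range: "y \<in> Y \<Longrightarrow> y m \<in> {1..k}"
  using cod_in Y_iff[of y] by (metis finite.emptyI finite.insertI insertI1)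

lemma Y_shift: "y \<in> Y \<Longrightarrow> (\<lambda>m. y (m + n)) \<in> Y"
  unfolding Y_iff
proof safe
  fix F :: "int set" assume y: "\<forall>F. finite F \<longrightarrow> (\<exists>v\<in>reg. \<forall>m\<in>F. cod v m = y m)" and "finite F"
  then obtain v where "v \<in> reg" "\<forall>m\<in>(\<lambda>m. m + n) ` F. cod v m = y m" by (meson finite_imageI)
  then show "\<exists>v\<in>reg. \<forall>m\<in>F. cod v m = y (m + n)"
    by (intro bexI[of _ "R n v"]) (auto simp: cod_R reg_R)
qed

lemma Z_iff: "z \<in> Z \<longleftrightarrow> (\<exists>y\<in>Y. \<exists>\<rho>. z = \<Phi> p y \<rho> \<and> (\<forall>m. \<rho> m \<in> {0..1}))"
  by (auto simp: Spoke_altdef)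

lemma shift_funpow: "(left_shift ^^ n) z m = z (m + int n)"
  by (induction n arbitrary: m) (auto simp: left_shift_def algebra_simps)

lemma shift_Z: "z \<in> Z \<Longrightarrow> (left_shift ^^ n) z \<in> Z"
proof -
  assume "z \<in> Z"
  then obtain y \<rho> where *: "y \<in> Y" "z = \<Phi> p y \<rho>" "\<forall>m. \<rho> m \<in> {0..1}" by (auto simp: Z_iff)
  then have "(left_shift ^^ n) z = \<Phi> p (\<lambda>m. y (m + int n)) (\<lambda>m. \<rho> (m + int n))"
    by (auto simp: fun_eq_iff shift_funpow \<Phi>_def)
  moreover have "(\<lambda>m. y (m + int n)) \<in> Y" using * Y_shift by simp
  ultimately show ?thesis unfolding Z_iff
    by (intro bexI[of _ "\<lambda>m. y (m + int n)"] exI[of _ "\<lambda>m. \<rho> (m + int n)"]) (use * in auto)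
qed

lemma Z_nonempty: "Z \<noteq> {}"
proof -
  obtain v where "v \<in> reg" using reg_dense[of UNIV] by auto
  then have "\<Phi> p (cod v) (\<lambda>_. 0) \<in> Z" unfolding Z_iff
    by (intro bexI[of _ "cod v"] exI[of _ "\<lambda>_. 0"]) (auto intro: cod_in_Y)
  then show ?thesis by auto
qed

end

section \<open>Completely positive mean dimension\<close>

lemma torus_nbhd_coordinates:
  assumes "open G" "torus_proj x \<in> G"
  shows "\<exists>\<epsilon>>0. \<forall>e. (\<forall>i. \<bar>e $ i\<bar> < \<epsilon>) \<longrightarrow> torus_proj (x + e) \<in> G"
proof -
  have "open (torus_proj -` G)" using assms by (simp add: open_torus_iff)
  then obtain r where r: "r > 0" "ball x r \<subseteq> torus_proj -` G"
    using assms(2) open_contains_ball by blast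
  show ?thesis
  proof (intro exI conjI allI impI)
    show "0 < r / (real CARD('a))" using r by simp
    fix e :: "real ^ 'a" assume e: "\<forall>i. \<bar>e $ i\<bar> < r / (real CARD('a))"
    have "norm e \<le> (\<Sum>i\<in>UNIV. \<bar>e $ i\<bar>)" by (rule norm_le_l1_cart)
    also have "\<dots> < (\<Sum>i\<in>(UNIV::'a set). r / (real CARD('a)))" using e by (intro sum_strict_mono) auto
    also have "\<dots> = r" by simp
    finally have "x + e \<in> ball x r" by (simp add: dist_norm)
    then show "torus_proj (x + e) \<in> G" using r by auto
  qed
qed

text \<open>Returns to \<open>G\<close> with positive density, by the pigeonhole principle: divide the unit cube into cells so
  small that two multiples of \<open>b\<close> in the same cell differ, modulo integers, by a vector that does not
  lead from \<open>v\<close> out of \<open>G\<close>.  The returns are counted from the time \<open>j0\<close>, which may exceed \<open>j\<close>.\<close>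

lemma rotation_returns:
  fixes b :: "real ^ 'd::finite"
  assumes "open G" "v \<in> G"
  shows "\<exists>M>0. \<forall>s. \<exists>J j0. J \<subseteq> {..<s} \<and> s \<le> M * card J \<and>
    (\<forall>j\<in>J. rotation ((real j - real j0) *\<^sub>R b) v \<in> G)"
proof -
  obtain x where x: "v = torus_proj x" using torus_proj_surj by blast
  obtain \<epsilon> where \<epsilon>: "\<epsilon> > 0" "\<And>e. (\<forall>i. \<bar>e $ i\<bar> < \<epsilon>) \<Longrightarrow> torus_proj (x + e) \<in> G"
    using torus_nbhd_coordinates[of G x] assms x by blast
  obtain g :: nat where g: "1 / \<epsilon> < real g" using reals_Archimedean2 by blast
  then have g0: "g > 0" using \<epsilon>(1) by (auto intro!: gr0I simp: field_simps)
  define cell :: "nat \<Rightarrow> 'd \<Rightarrow> int" where "cell j = (\<lambda>l. \<lfloor>real g * frac (real j * b $ l)\<rfloor>)" for j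
  define Cs :: "('d \<Rightarrow> int) set" where "Cs = (UNIV \<rightarrow>\<^sub>E {0..<int g})"
  have fCs: "finite Cs" by (auto simp: Cs_def intro: finite_PiE)
  have cell: "cell j \<in> Cs" for j
  proof -
    have "real g * frac (real j * b $ l) < real g * 1" for l
      using frac_lt_1[of "real j * b $ l"] g0 by (intro mult_strict_left_mono) auto
    then show ?thesis by (auto simp: Cs_def cell_def floor_less_iff PiE_iff)
  qed
  have M0: "card Cs > 0" using fCs cell[of 0] by (auto simp: card_gt_0_iff)
  show ?thesis
  proof (intro exI[of _ "card Cs"] conjI allI)
    fix s
    have "\<exists>c\<in>Cs. s \<le> card Cs * card {j \<in> {..<s}. cell j = c}"
    proof (rule ccontr)
      assume "\<not> ?thesis"
      then have less: "card Cs * card {j \<in> {..<s}. cell j = c} < s" if "c \<in> Cs" for c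
        using that by (auto simp: not_le)
      have "card {..<s} = card (\<Union>c\<in>Cs. {j \<in> {..<s}. cell j = c})"
        by (rule arg_cong[of _ _ card]) (use cell in auto)
      then have "s \<le> (\<Sum>c\<in>Cs. card {j \<in> {..<s}. cell j = c})"
        using card_UN_le[OF fCs, of "\<lambda>c. {j \<in> {..<s}. cell j = c}"] by (metis card_lessThan)
      then have "card Cs * s \<le> (\<Sum>c\<in>Cs. card Cs * card {j \<in> {..<s}. cell j = c})"
        by (simp flip: sum_distrib_left)
      also have "\<dots> < (\<Sum>c\<in>Cs. s)" using less fCs M0 by (intro sum_strict_mono) auto
      finally show False by simp
    qed
    then obtain c where c: "c \<in> Cs" "s \<le> card Cs * card {j \<in> {..<s}. cell j = c}" by auto
    define j0 where "j0 = (SOME j. j \<in> {j \<in> {..<s}. cell j = c})"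
    have "rotation ((real j - real j0) *\<^sub>R b) v \<in> G" if j: "j \<in> {j \<in> {..<s}. cell j = c}" for j
    proof -
      have j0: "cell j0 = c" using someI[of "\<lambda>j. j \<in> {j \<in> {..<s}. cell j = c}", OF j] by (simp add: j0_def)
      define e :: "real ^ 'd" where "e = (\<chi> l. frac (real j * b $ l) - frac (real j0 * b $ l))"
      have "\<bar>e $ l\<bar> < \<epsilon>" for l
      proof -
        have "\<lfloor>real g * frac (real j * b $ l)\<rfloor> = \<lfloor>real g * frac (real j0 * b $ l)\<rfloor>"
          using j j0 by (auto simp: cell_def dest: fun_cong)
        then have "\<bar>real g * frac (real j * b $ l) - real g * frac (real j0 * b $ l)\<bar> < 1"
          by linarith
        then have "real g * \<bar>e $ l\<bar> < 1"
          by (simp add: e_def abs_mult flip: right_diff_distrib)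
        moreover have "1 < real g * \<epsilon>" using g \<epsilon>(1) by (simp add: field_simps)
        ultimately have "real g * \<bar>e $ l\<bar> < real g * \<epsilon>" by linarith
        then show ?thesis using g0 by simp
      qed
      then have "torus_proj (x + e) \<in> G" using \<epsilon>(2) by blast
      moreover have "torus_proj (x + e) = torus_proj (x + (real j - real j0) *\<^sub>R b)"
        unfolding torus_proj_eq_iff by (auto simp: e_def frac_def algebra_simps)
      ultimately show ?thesis by (simp add: x)
    qed
    then show "\<exists>J j0. J \<subseteq> {..<s} \<and> s \<le> card Cs * card J \<and>
        (\<forall>j\<in>J. rotation ((real j - real j0) *\<^sub>R b) v \<in> G)"
      using c by (intro exI[of _ "{j \<in> {..<s}. cell j = c}"] exI[of _ j0]) auto
  qed (rule M0)
qed

lemma factor_map_funpow: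
  assumes \<pi>: "factor_map X T W S \<pi>" and T: "\<And>x. x \<in> topspace X \<Longrightarrow> T x \<in> topspace X"
    and x: "x \<in> topspace X"
  shows "(S ^^ n) (\<pi> x) = \<pi> ((T ^^ n) x) \<and> (T ^^ n) x \<in> topspace X"
proof (induction n)
  case (Suc n)
  then show ?case using T \<pi> by (auto simp: factor_map_def)
qed (use x in auto)

lemma finite_int_window:
  fixes F :: "int set"
  assumes "finite F"
  shows "\<exists>N::nat. F \<subseteq> {- int N..int N}"
proof -
  have "F \<subseteq> {- int (nat (Max (insert 0 (abs ` F))))..int (nat (Max (insert 0 (abs ` F))))}"
  proof
    fix m assume "m \<in> F"
    then have "\<bar>m\<bar> \<le> Max (insert 0 (abs ` F))" using assms by (intro Max_ge) auto
    then show "m \<in> {- int (nat (Max (insert 0 (abs ` F))))..int (nat (Max (insert 0 (abs ` F))))}" by auto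
  qed
  then show ?thesis by blast
qed

lemma regular_Hausdorff_separated_neighbourhoods:
  assumes "regular_space W" "Hausdorff_space W" "x \<in> topspace W" "y \<in> topspace W" "x \<noteq> y"
  obtains V1 V2 Q1 Q2 where "openin W V1" "openin W V2" "V1 \<union> V2 = topspace W"
    "openin W Q1" "openin W Q2" "Q1 \<inter> V1 = {}" "Q2 \<inter> V2 = {}" "x \<in> Q1" "y \<in> Q2"
proof -
  obtain A B where AB: "openin W A" "openin W B" "x \<in> A" "y \<in> B" "disjnt A B"
    using assms unfolding Hausdorff_space_def by metis
  have reg: "\<exists>Q V. openin W Q \<and> openin W V \<and> u \<in> Q \<and> topspace W - C \<subseteq> V \<and> disjnt Q V"
    if "openin W C" "u \<in> C" for C u
    using assms(1) that openin_subset[OF that(1)] unfolding regular_space_def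
    by (metis DiffD2 DiffI Diff_Diff_Int closedin_diff closedin_topspace subsetD)
  obtain Q1 V1 where 1: "openin W Q1" "openin W V1" "x \<in> Q1" "topspace W - A \<subseteq> V1" "disjnt Q1 V1"
    using reg[OF AB(1,3)] by blast
  obtain Q2 V2 where 2: "openin W Q2" "openin W V2" "y \<in> Q2" "topspace W - B \<subseteq> V2" "disjnt Q2 V2"
    using reg[OF AB(2,4)] by blast
  show ?thesis
  proof (rule that[of V1 V2 Q1 Q2])
    show "V1 \<union> V2 = topspace W"
      using 1 2 AB(5) openin_subset[OF 1(2)] openin_subset[OF 2(2)] by (auto simp: disjnt_def)
  qed (use 1 2 in \<open>auto simp: disjnt_def\<close>)
qed

context rotation_coding
begin

lemma zero_in_Z: "(\<lambda>_. 0) \<in> Z"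
proof -
  obtain v where v: "v \<in> reg" using reg_dense[of UNIV] by auto
  show ?thesis unfolding Z_iff
    by (intro bexI[of _ "cod v"] exI[of _ "\<lambda>_. 0"]) (auto simp: \<Phi>_def intro: cod_in_Y v)
qed

text \<open>A cube of points of \<open>Z\<close> that carry, around the times \<open>\<nu> 0, \<nu> 1, \<dots>\<close> below \<open>n\<close>, independently scaled
  copies of the window \<open>[-N, N]\<close> of \<open>z\<close>.\<close>

definition cube_of_copies ::
  "nat \<Rightarrow> (int \<Rightarrow> real ^ 2) \<Rightarrow> nat \<Rightarrow> nat \<Rightarrow> ((nat \<Rightarrow> real) \<Rightarrow> int \<Rightarrow> real ^ 2) \<Rightarrow> (nat \<Rightarrow> nat) \<Rightarrow> bool" where
  "cube_of_copies N z n K \<psi> \<nu> \<longleftrightarrow>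
     (\<forall>i<K. \<nu> i < n) \<and> continuous_on hilbert_cube \<psi> \<and> \<psi> ` hilbert_cube \<subseteq> Z \<and>
     (\<forall>t\<in>hilbert_cube. \<forall>i<K. \<forall>m\<in>{- int N..int N}. \<psi> t (m + int (\<nu> i)) = t i *\<^sub>R z m)"

text \<open>Times that are multiples of \<open>L = 2 N + 1\<close> have disjoint windows.  Among the first \<open>s\<close> multiples, a
  proportion of at least \<open>1 / M\<close> are times at which the address of a suitable regular point repeats the
  word of \<open>y\<close> on \<open>[-N, N]\<close>.\<close>

lemma independent_copies:
  assumes y: "y \<in> Y" and \<rho>: "\<And>m. \<rho> m \<in> {0..1}"
  shows "\<exists>L M. L > 0 \<and> M > 0 \<and> (\<forall>s. \<exists>K \<psi> n. s \<le> M * K \<and> cube_of_copies N (\<Phi> p y \<rho>) (L * s) K \<psi> n)"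
proof -
  obtain v where v: "v \<in> reg" "\<And>m. m \<in> {- int N..int N} \<Longrightarrow> cod v m = y m"
    using y Y_iff[of y] by (metis finite_atLeastAtMost_int)
  define G where "G = (\<Inter>m\<in>{- int N..int N}. R m -` U (y m))"
  have "open G"
    unfolding G_def using U_open Y_range[OF y] by (intro open_INT ballI open_vimage_rotation) auto
  moreover have "v \<in> G"
    using cod_in[OF v(1)] v(2) by (auto simp: G_def) (metis atLeastAtMost_iff)
  define L where "L = 2 * N + 1"
  ultimately obtain M where M: "M > 0" "\<And>s. \<exists>J j0. J \<subseteq> {..<s} \<and> s \<le> M * card J \<and>
    (\<forall>j\<in>J. rotation ((real j - real j0) *\<^sub>R (real L *\<^sub>R a)) v \<in> G)"
    using rotation_returns[of G v "real L *\<^sub>R a"] \<open>v \<in> G\<close> by blast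
  show ?thesis
  proof (rule exI[of _ L], rule exI[of _ M], intro conjI allI)
    fix s
    obtain J j0 where J: "J \<subseteq> {..<s}" "s \<le> M * card J"
      "\<And>j. j \<in> J \<Longrightarrow> rotation ((real j - real j0) *\<^sub>R (real L *\<^sub>R a)) v \<in> G"
      using M(2)[of s] by blast
    have fJ: "finite J" using J(1) finite_subset by blast
    obtain e where e: "bij_betw e {..<card J} J"
      using ex_bij_betw_nat_finite[OF fJ] by (auto simp: atLeast0LessThan)
    define v' where "v' = R (- int (L * j0)) v"
    have v': "v' \<in> reg" using v reg_R by (simp only: v'_def)
    have word: "cod v' (m + int (L * j)) = y m" if j: "j \<in> J" and m: "m \<in> {- int N..int N}" for j m
    proof -
      have "R (m + int (L * j)) v' = R m (rotation ((real j - real j0) *\<^sub>R (real L *\<^sub>R a)) v)"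
        by (simp add: v'_def algebra_simps)
      also have "\<dots> \<in> U (y m)" using J(3)[OF j] m by (auto simp: G_def)
      finally show ?thesis using cod_iff[OF v' Y_range[OF y]] by blast
    qed
    \<comment> \<open>The index of the block of length \<open>L\<close> that contains \<open>m\<close>, and the position of \<open>m\<close> in this block.\<close>
    define blk where "blk m = (m + int N) div int L" for m
    define off where "off m = (m + int N) mod int L - int N" for m
    define \<tau> where "\<tau> t m = (if blk m \<ge> 0 \<and> nat (blk m) \<in> J
      then t (the_inv_into {..<card J} e (nat (blk m))) * \<rho> (off m) else 0)" for t :: "nat \<Rightarrow> real" and m
    define \<psi> where "\<psi> t = \<Phi> p (cod v') (\<tau> t)" for t
    have blk: "blk (m + int (L * j)) = int j" "off (m + int (L * j)) = m"
      if "m \<in> {- int N..int N}" for m j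
    proof -
      have *: "m + int (L * j) + int N = (m + int N) + int j * int L" by simp
      have "0 \<le> m + int N" "m + int N < int L" using that by (auto simp: L_def)
      then show "blk (m + int (L * j)) = int j" "off (m + int (L * j)) = m"
        unfolding blk_def off_def * by (simp_all add: L_def)
    qed
    show "\<exists>K \<psi> n. s \<le> M * K \<and> cube_of_copies N (\<Phi> p y \<rho>) (L * s) K \<psi> n"
      unfolding cube_of_copies_def
    proof (intro exI[of _ "card J"] exI[of _ \<psi>] exI[of _ "\<lambda>i. L * e i"] conjI allI ballI impI)
      show "s \<le> M * card J" by fact
      fix i assume i: "i < card J"
      then have ei: "e i \<in> J" using e by (auto simp: bij_betw_def)
      then have "e i < s" using J(1) by auto
      then show "L * e i < L * s" by (simp add: L_def del: mult_Suc)
      fix t m assume t: "t \<in> hilbert_cube" and m: "m \<in> {- int N..int N}"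
      have "the_inv_into {..<card J} e (e i) = i"
        using e i by (intro the_inv_into_f_f) (auto simp: bij_betw_def)
      then have "\<tau> t (m + int (L * e i)) = t i * \<rho> m"
        unfolding \<tau>_def blk[OF m] using ei by simp
      then show "\<psi> t (m + int (L * e i)) = t i *\<^sub>R \<Phi> p y \<rho> m"
        using word[OF ei m] by (simp add: \<psi>_def \<Phi>_def)
    next
      have "continuous_on hilbert_cube (\<lambda>t. \<psi> t m)" for m
        unfolding \<psi>_def \<Phi>_def \<tau>_def
        by (cases "blk m \<ge> 0 \<and> nat (blk m) \<in> J") (auto intro!: continuous_intros continuous_coordinate)
      then show "continuous_on hilbert_cube \<psi>" by (rule continuous_on_coordinatewise_then_product)
      show "\<psi> ` hilbert_cube \<subseteq> Z"
      proof safe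
        fix t assume "t \<in> hilbert_cube"
        then have "\<tau> t m \<in> {0..1}" for m
          using \<rho>[of "off m"] by (auto simp: \<tau>_def hilbert_cube_def intro!: mult_le_one)
        then show "\<psi> t \<in> Z" unfolding Z_iff \<psi>_def
          by (intro bexI[of _ "cod v'"] exI[of _ "\<tau> t"]) (auto intro: cod_in_Y v')
      qed
    qed
  qed (use M in \<open>auto simp: L_def\<close>)
qed

text \<open>A member of a refinement of the \<open>n\<close>-th iterated cover avoids, at each time, \<open>Q1\<close> or \<open>Q2\<close>; pulled back
  to a cube of copies of \<open>z\<close>, it cannot meet opposite faces.\<close>

lemma mdim_cover_factor_pos:
  assumes W: "top_dyn_system W S" and \<pi>: "factor_map (top_of_set Z) left_shift W S \<pi>"
    and z: "z \<in> Z"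
    and V: "openin W V1" "openin W V2" "V1 \<union> V2 = topspace W"
    and Q: "openin W Q1" "openin W Q2" "Q1 \<inter> V1 = {}" "Q2 \<inter> V2 = {}" "\<pi> z \<in> Q1" "\<pi> (\<lambda>_. 0) \<in> Q2"
  shows "mdim_cover W S {V1, V2} > 0"
proof -
  have c\<pi>: "continuous_map (top_of_set Z) W \<pi>" using \<pi> by (simp add: factor_map_def)
  have cS: "continuous_map W W S" and mW: "metrizable_space W"
    using W by (auto simp: top_dyn_system_def homeomorphic_imp_continuous_map)
  have window: "\<exists>F. finite F \<and> (\<forall>x\<in>Z. (\<forall>m\<in>F. x m = u m) \<longrightarrow> \<pi> x \<in> Q)"
    if "openin W Q" "u \<in> Z" "\<pi> u \<in> Q" for Q u
  proof -
    have "openin (top_of_set Z) {x \<in> topspace (top_of_set Z). \<pi> x \<in> Q}"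
      by (rule openin_continuous_map_preimage[OF c\<pi> that(1)])
    then obtain G where G: "open G" "{x \<in> Z. \<pi> x \<in> Q} = Z \<inter> G" by (auto simp: openin_open)
    then have "u \<in> G" using that by blast
    then obtain F where "finite F" "\<forall>x. (\<forall>m\<in>F. x m = u m) \<longrightarrow> x \<in> G" using open_fun_agree[OF G(1)] by blast
    then show ?thesis using G(2) by (intro exI[of _ F]) blast
  qed
  obtain F1 where F1: "finite F1" "\<And>x. x \<in> Z \<Longrightarrow> (\<And>m. m \<in> F1 \<Longrightarrow> x m = z m) \<Longrightarrow> \<pi> x \<in> Q1"
    using window[OF Q(1) z Q(5)] by metis
  obtain F2 where F2: "finite F2" "\<And>x. x \<in> Z \<Longrightarrow> (\<And>m. m \<in> F2 \<Longrightarrow> x m = 0) \<Longrightarrow> \<pi> x \<in> Q2"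
    using window[OF Q(2) zero_in_Z Q(6)] by metis
  obtain N where N: "F1 \<union> F2 \<subseteq> {- int N..int N}" using finite_int_window[of "F1 \<union> F2"] F1 F2 by auto
  obtain y \<rho> where z': "y \<in> Y" "z = \<Phi> p y \<rho>" "\<And>m. \<rho> m \<in> {0..1}" using z by (auto simp: Z_iff)
  obtain L M where LM: "L > 0" "M > 0" and copies: "\<And>s. \<exists>K \<psi> n. s \<le> M * K \<and> cube_of_copies N z (L * s) K \<psi> n"
    using independent_copies[of y \<rho> N] z' by blast
  have ne: "topspace W \<noteq> {}" using \<pi> z by (auto simp: factor_map_def)
  have foc: "finite_open_cover W {V1, V2}" using V by (auto simp: finite_open_cover_def)
  let ?D = "\<lambda>n. cover_dim W (iterated_cover W S {V1, V2} n)"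
  have lower: "s \<le> M * ?D (L * s)" for s
  proof -
    obtain K \<psi> n where sK: "s \<le> M * K" and cc: "cube_of_copies N z (L * s) K \<psi> n"
      using copies[of s] by blast
    have K: "\<And>i. i < K \<Longrightarrow> n i < L * s" and c\<psi>: "continuous_on hilbert_cube \<psi>"
      and \<psi>Z: "\<psi> ` hilbert_cube \<subseteq> Z"
      and \<psi>: "\<And>t i m. t \<in> hilbert_cube \<Longrightarrow> i < K \<Longrightarrow> m \<in> {- int N..int N} \<Longrightarrow> \<psi> t (m + int (n i)) = t i *\<^sub>R z m"
      using cc unfolding cube_of_copies_def by blast+
    let ?f = "\<lambda>t. \<pi> (\<psi> t)"
    have cf: "continuous_map (top_of_set hilbert_cube) W ?f"
      using continuous_map_compose[of "top_of_set hilbert_cube" "top_of_set Z" \<psi> W \<pi>] c\<psi> \<psi>Z c\<pi>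
      by (simp add: o_def image_subset_iff_funcset)
    have orbit: "(S ^^ j) (?f t) = \<pi> ((left_shift ^^ j) (\<psi> t))" "(left_shift ^^ j) (\<psi> t) \<in> Z"
      if "t \<in> hilbert_cube" for j t
      using factor_map_funpow[OF \<pi>, of "\<psi> t" j] shift_Z[of _ 1] \<psi>Z that by auto
    have hit1: "(S ^^ n i) (?f t) \<in> Q1" if t: "t \<in> hilbert_cube" "i < K" "t i = 1" for t i
      unfolding orbit(1)[OF t(1)]
    proof (rule F1(2)[OF orbit(2)[OF t(1)]])
      fix m assume "m \<in> F1"
      then show "(left_shift ^^ n i) (\<psi> t) m = z m" using \<psi>[OF t(1,2), of m] N t(3) by (auto simp: shift_funpow)
    qed
    have hit2: "(S ^^ n i) (?f t) \<in> Q2" if t: "t \<in> hilbert_cube" "i < K" "t i = 0" for t i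
      unfolding orbit(1)[OF t(1)]
    proof (rule F2(2)[OF orbit(2)[OF t(1)]])
      fix m assume "m \<in> F2"
      then show "(left_shift ^^ n i) (\<psi> t) m = 0" using \<psi>[OF t(1,2), of m] N t(3) by (auto simp: shift_funpow)
    qed
    obtain \<gamma> where \<gamma>: "finite_open_cover W \<gamma>" "refines \<gamma> (iterated_cover W S {V1, V2} (L * s))"
      "cover_ord W \<gamma> = ?D (L * s)"
      using cover_dim_attained[OF finite_open_cover_iterated[OF cS foc]] by blast
    have f\<gamma>: "finite \<gamma>" using \<gamma> by (auto simp: finite_open_cover_def)
    define pb where "pb B = {t \<in> hilbert_cube. ?f t \<in> B}" for B
    have "\<exists>x\<in>hilbert_cube. K + 1 \<le> card {V \<in> pb ` \<gamma>. x \<in> V}"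
    proof (rule Lebesgue_covering)
      show "finite (pb ` \<gamma>)" using f\<gamma> by simp
      show "openin (top_of_set hilbert_cube) C" if "C \<in> pb ` \<gamma>" for C
      proof -
        obtain B where "B \<in> \<gamma>" "C = pb B" using \<open>C \<in> pb ` \<gamma>\<close> by blast
        moreover have "openin W B" using \<gamma>(1) \<open>B \<in> \<gamma>\<close> by (auto simp: finite_open_cover_def)
        ultimately show ?thesis
          using openin_continuous_map_preimage[OF cf, of B] by (simp add: pb_def)
      qed
      show "hilbert_cube \<subseteq> \<Union>(pb ` \<gamma>)"
      proof
        fix t assume t: "t \<in> hilbert_cube"
        then have "?f t \<in> topspace W" using cf by (auto simp: continuous_map_def)
        then show "t \<in> \<Union>(pb ` \<gamma>)" using \<gamma>(1) t by (auto simp: finite_open_cover_def pb_def)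
      qed
      fix C i x x' assume C: "C \<in> pb ` \<gamma>" and i: "i < K" and x: "x \<in> C" "x' \<in> C" "x i = 0" "x' i = 1"
      obtain B where B: "B \<in> \<gamma>" "C = pb B" using C by blast
      obtain f where f: "\<forall>j<L * s. f j \<in> {V1, V2}" "B \<subseteq> topspace W \<inter> (\<Inter>j<L * s. (S ^^ j) -` f j)"
        using \<gamma>(2) B(1) unfolding refines_def iterated_cover_def by blast
      have "(S ^^ n i) (?f x) \<in> f (n i)" "(S ^^ n i) (?f x') \<in> f (n i)"
        using f(2) x B(2) K[OF i] by (auto simp: pb_def)
      moreover have "(S ^^ n i) (?f x) \<in> Q2" "(S ^^ n i) (?f x') \<in> Q1"
        using hit2[of x i] hit1[of x' i] x i B(2) by (auto simp: pb_def)
      moreover have "f (n i) \<in> {V1, V2}" using f(1) K[OF i] by blast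
      ultimately show False using Q(3,4) by auto
    qed
    then obtain x where x: "x \<in> hilbert_cube" "K + 1 \<le> card {V \<in> pb ` \<gamma>. x \<in> V}" by blast
    have "?f x \<in> topspace W" using cf x by (auto simp: continuous_map_def)
    have "{V \<in> pb ` \<gamma>. x \<in> V} \<subseteq> pb ` {B \<in> \<gamma>. ?f x \<in> B}" by (auto simp: pb_def)
    then have "card {V \<in> pb ` \<gamma>. x \<in> V} \<le> card {B \<in> \<gamma>. ?f x \<in> B}"
      using f\<gamma> by (intro surj_card_le[where f = pb]) auto
    then have "K \<le> ?D (L * s)"
      using card_le_cover_ord[OF f\<gamma> \<open>?f x \<in> topspace W\<close>] x(2) \<gamma>(3) by linarith
    then show ?thesis using sK by (meson mult_le_mono2 order_trans)
  qed
  have "(\<lambda>n. real (?D n) / real n) \<longlonglongrightarrow> mdim_cover W S {V1, V2}"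
    by (rule mdim_cover_LIMSEQ[OF mW ne cS foc])
  moreover have "strict_mono (\<lambda>s. L * s)" using LM by (auto simp: strict_mono_def)
  ultimately have "(\<lambda>s. real (?D (L * s)) / real (L * s)) \<longlonglongrightarrow> mdim_cover W S {V1, V2}"
    by (auto dest: LIMSEQ_subseq_LIMSEQ simp: o_def)
  moreover have "1 / (real M * real L) \<le> real (?D (L * s)) / real (L * s)" if "s \<ge> 1" for s
  proof -
    have "real s \<le> real M * real (?D (L * s))" using lower[of s] by (metis of_nat_le_iff of_nat_mult)
    then show ?thesis using LM that by (simp add: field_simps)
  qed
  ultimately have "1 / (real M * real L) \<le> mdim_cover W S {V1, V2}"
    by (intro LIMSEQ_le_const) auto
  moreover have "0 < 1 / (real M * real L)" using LM by simp
  ultimately show ?thesis by linarith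
qed

lemma CPMD: "has_CPMD TYPE('b) (top_of_set Z) left_shift"
  unfolding has_CPMD_def
proof
  assume "\<exists>(W :: 'b topology) S \<pi>. top_dyn_system W S \<and> factor_map (top_of_set Z) left_shift W S \<pi> \<and>
    (\<exists>y\<in>topspace W. \<exists>y'\<in>topspace W. y \<noteq> y') \<and> mdim W S = 0"
  then obtain W :: "'b topology" and S \<pi> w w' where W: "top_dyn_system W S"
    and \<pi>: "factor_map (top_of_set Z) left_shift W S \<pi>"
    and w: "w \<in> topspace W" "w' \<in> topspace W" "w \<noteq> w'" and mdim: "mdim W S = 0"
    by blast
  obtain u where u: "u \<in> topspace W" "u \<noteq> \<pi> (\<lambda>_. 0)" using w by metis
  then obtain z where z: "z \<in> Z" "u = \<pi> z" using \<pi> by (auto simp: factor_map_def)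
  have mW: "metrizable_space W" using W by (simp add: top_dyn_system_def)
  have "\<pi> z \<in> topspace W" "\<pi> (\<lambda>_. 0) \<in> topspace W" "\<pi> z \<noteq> \<pi> (\<lambda>_. 0)"
    using \<pi> z zero_in_Z u by (auto simp: factor_map_def)
  then obtain V1 V2 Q1 Q2 where V: "openin W V1" "openin W V2" "V1 \<union> V2 = topspace W"
    and Q: "openin W Q1" "openin W Q2" "Q1 \<inter> V1 = {}" "Q2 \<inter> V2 = {}" "\<pi> z \<in> Q1" "\<pi> (\<lambda>_. 0) \<in> Q2"
    using regular_Hausdorff_separated_neighbourhoods[OF metrizable_imp_regular_space[OF mW]
        metrizable_imp_Hausdorff_space[OF mW]] by metis
  have "mdim_cover W S {V1, V2} > 0"
    by (rule mdim_cover_factor_pos[OF W \<pi> z(1) V Q])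
  moreover have "ereal (mdim_cover W S {V1, V2}) \<le> mdim W S"
    unfolding mdim_def using V by (intro SUP_upper) (auto simp: finite_open_cover_def)
  ultimately show False using mdim by (simp add: zero_ereal_def)
qed

end

section \<open>A cover that sees one symbol\<close>

lemma not_in_closure_of: "openin X T \<Longrightarrow> x \<in> T \<Longrightarrow> T \<inter> S = {} \<Longrightarrow> x \<notin> X closure_of S"
  unfolding in_closure_of by blast

context rotation_coding
begin

text \<open>At least the reciprocal of every distance between two of the points \<open>p\<close>; the diagonal terms are
  \<open>1 / 0 = 0\<close>.\<close>

definition spread :: real where
  "spread = (\<Sum>i\<in>{1..k}. \<Sum>j\<in>{1..k}. 1 / norm (p i - p j))"

text \<open>On the spokes, the distance from the hub on spoke \<open>j\<close>, and \<open>0\<close> on the other spokes; this formula is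
  continuous on the entire plane.\<close>

definition spoke_coord :: "nat \<Rightarrow> real ^ 2 \<Rightarrow> real" where
  "spoke_coord j x = max 0 (norm x - spread * norm (x - norm x *\<^sub>R p j))"

lemma spread: "i \<in> {1..k} \<Longrightarrow> j \<in> {1..k} \<Longrightarrow> i \<noteq> j \<Longrightarrow> 1 \<le> spread * norm (p i - p j)"
proof -
  assume ij: "i \<in> {1..k}" "j \<in> {1..k}" "i \<noteq> j"
  then have pos: "0 < norm (p i - p j)" using p_inj by (auto dest: inj_onD)
  have "1 / norm (p i - p j) \<le> (\<Sum>j\<in>{1..k}. 1 / norm (p i - p j))"
    using ij by (intro member_le_sum) auto
  also have "\<dots> \<le> spread"
    unfolding spread_def using ij
    by (intro member_le_sum[where f = "\<lambda>i. \<Sum>j\<in>{1..k}. 1 / norm (p i - p j)"]) (auto intro: sum_nonneg)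
  finally show ?thesis using pos by (simp add: field_simps)
qed

lemma norm_p: "i \<in> {1..k} \<Longrightarrow> norm (p i) = 1"
  using p_sphere by auto

lemma spoke_coord_spoke:
  assumes "i \<in> {1..k}" "j \<in> {1..k}" "0 \<le> t"
  shows "spoke_coord j (t *\<^sub>R p i) = (if i = j then t else 0)"
proof -
  have "norm (t *\<^sub>R p i - norm (t *\<^sub>R p i) *\<^sub>R p j) = t * norm (p i - p j)"
    using assms by (simp add: norm_p flip: scaleR_diff_right)
  then have "spoke_coord j (t *\<^sub>R p i) = max 0 (t * (1 - spread * norm (p i - p j)))"
    using assms by (simp add: spoke_coord_def norm_p algebra_simps)
  moreover have "t * (1 - spread * norm (p i - p j)) \<le> 0" if "i \<noteq> j"
    using spread[of i j] assms that by (intro mult_nonneg_nonpos) auto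
  ultimately show ?thesis using assms by (auto simp: max_def)
qed

lemma continuous_spoke_coord [continuous_intros]:
  "continuous_on S f \<Longrightarrow> continuous_on S (\<lambda>x. spoke_coord j (f x))"
  unfolding spoke_coord_def by (intro continuous_intros)

text \<open>At coordinates where \<open>z\<close> vanishes the address is arbitrary.\<close>

definition address :: "(int \<Rightarrow> real ^ 2) \<Rightarrow> int \<Rightarrow> nat" where
  "address z = (SOME y. y \<in> Y \<and> (\<exists>\<rho>. z = \<Phi> p y \<rho> \<and> (\<forall>m. \<rho> m \<in> {0..1})))"

lemma address:
  assumes "z \<in> Z"
  shows "address z \<in> Y" "z m = norm (z m) *\<^sub>R p (address z m)"
proof -
  have "address z \<in> Y \<and> (\<exists>\<rho>. z = \<Phi> p (address z) \<rho> \<and> (\<forall>m. \<rho> m \<in> {0..1}))"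
    unfolding address_def
    by (rule someI_ex[of "\<lambda>y. y \<in> Y \<and> (\<exists>\<rho>. z = \<Phi> p y \<rho> \<and> (\<forall>m. \<rho> m \<in> {0..1}))"])
      (use assms in \<open>simp add: Z_iff Bex_def\<close>)
  then obtain \<rho> where *: "address z \<in> Y" "z = \<Phi> p (address z) \<rho>" "\<And>m. \<rho> m \<in> {0..1}" by blast
  then have "z m = \<rho> m *\<^sub>R p (address z m)" by (metis \<Phi>_def)
  then have "norm (z m) = \<rho> m" using *(3)[of m] norm_p[OF Y_range[OF *(1)]] by simp
  then show "address z \<in> Y" "z m = norm (z m) *\<^sub>R p (address z m)"
    using *(1) \<open>z m = \<rho> m *\<^sub>R p (address z m)\<close> by auto
qed

lemma address_range: "z \<in> Z \<Longrightarrow> address z m \<in> {1..k}"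
  using address(1) Y_range by blast

lemma spoke_coord_Z:
  assumes "z \<in> Z" "j \<in> {1..k}"
  shows "spoke_coord j (z m) = (if address z m = j then norm (z m) else 0)"
  using spoke_coord_spoke[OF address_range[OF assms(1), of m] assms(2) norm_ge_zero[of "z m"]]
  by (simp flip: address(2)[OF assms(1)])

text \<open>Away from the outer half of spoke \<open>1\<close>, and away from the outer halves of the other spokes.\<close>

definition W0 where "W0 = {z \<in> Z. spoke_coord 1 (z 0) < 1 / 2}"
definition W1 where "W1 = {z \<in> Z. norm (z 0) - spoke_coord 1 (z 0) < 1 / 2}"
abbreviation "\<beta> \<equiv> {W0, W1}"

lemma one_in: "1 \<in> {1..k}" and two_in: "2 \<in> {1..k}"
  using k2 by auto

lemma shift_in_W:
  assumes "z \<in> Z"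
  shows "(left_shift ^^ i) z \<in> W0 \<longleftrightarrow> \<not> (address z (int i) = 1 \<and> norm (z (int i)) \<ge> 1 / 2)"
    and "(left_shift ^^ i) z \<in> W1 \<longleftrightarrow> \<not> (address z (int i) \<noteq> 1 \<and> norm (z (int i)) \<ge> 1 / 2)"
  using shift_Z[OF assms, of i] spoke_coord_Z[OF assms one_in, of "int i"]
  by (auto simp: W0_def W1_def shift_funpow)

text \<open>All radii equal to \<open>1\<close>, so that every symbol of the address is visible.\<close>

definition rim :: "'d torus \<Rightarrow> int \<Rightarrow> real ^ 2" where
  "rim v = \<Phi> p (cod v) (\<lambda>_. 1)"

lemma rim:
  assumes "v \<in> reg"
  shows "rim v \<in> Z" "norm (rim v m) = 1" "address (rim v) m = cod v m"
proof -
  show Z: "rim v \<in> Z" unfolding rim_def Z_iff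
    by (intro bexI[of _ "cod v"] exI[of _ "\<lambda>_. 1"]) (auto intro: cod_in_Y assms)
  show n: "norm (rim v m) = 1" using cod_in[OF assms] norm_p by (auto simp: rim_def \<Phi>_def)
  have "rim v m = p (address (rim v) m)"
    using address(2)[OF Z, of m] unfolding n by simp
  moreover have "rim v m = p (cod v m)" by (simp add: rim_def \<Phi>_def)
  ultimately have "p (cod v m) = p (address (rim v) m)" by simp
  then show "address (rim v) m = cod v m"
    using p_inj cod_in[OF assms] address_range[OF Z] by (metis inj_onD)
qed

lemma openin_Z_less:
  fixes f g :: "(int \<Rightarrow> real ^ 2) \<Rightarrow> real"
  assumes "continuous_on Z f" "continuous_on Z g"
  shows "openin (top_of_set Z) {z \<in> Z. f z < g z}"
proof -
  have "{z \<in> Z. f z < g z} = Z \<inter> (\<lambda>z. g z - f z) -` {0<..}" by auto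
  moreover have "continuous_on Z (\<lambda>z. g z - f z)" using assms by (intro continuous_intros)
  ultimately show ?thesis by (simp add: continuous_openin_preimage_gen)
qed

lemma standard_\<beta>: "standard_open_cover (top_of_set Z) \<beta>"
proof -
  obtain v1 where v1: "v1 \<in> reg" "v1 \<in> U 1" using reg_dense[of "U 1"] U_open[OF one_in] by blast
  obtain v2 where v2: "v2 \<in> reg" "v2 \<in> U 2" using reg_dense[of "U 2"] U_open[OF two_in] by blast
  have cod: "cod v1 0 = 1" "cod v2 0 = 2"
    using cod_iff[OF v1(1) one_in, of 0] cod_iff[OF v2(1) two_in, of 0] v1 v2 by auto
  have c: "continuous_on Z (\<lambda>z. spoke_coord 1 (z 0))" "continuous_on Z (\<lambda>z. norm (z 0) - spoke_coord 1 (z 0))"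
    by (intro continuous_intros continuous_coordinate)+
  have val: "spoke_coord 1 (rim v1 0) = 1" "spoke_coord 1 (rim v2 0) = 0" "norm (rim v2 0) = 1" "norm (rim v1 0) = 1"
    using spoke_coord_Z[OF rim(1)[OF v1(1)] one_in, of 0] spoke_coord_Z[OF rim(1)[OF v2(1)] one_in, of 0]
      rim[OF v1(1)] rim[OF v2(1)] cod by auto
  have "openin (top_of_set Z) W0" "openin (top_of_set Z) W1"
    unfolding W0_def W1_def
    by (rule openin_Z_less[OF c(1) continuous_on_const], rule openin_Z_less[OF c(2) continuous_on_const])
  moreover have "W0 \<union> W1 = Z"
    using shift_in_W[of _ 0] by (auto simp: W0_def W1_def)
  ultimately have "finite_open_cover (top_of_set Z) \<beta>" by (auto simp: finite_open_cover_def)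
  moreover have "rim v1 \<in> W1" "rim v1 \<notin> W0"
    using rim(1)[OF v1(1)] val by (auto simp: W0_def W1_def)
  then have "card \<beta> = 2" by (metis card_2_iff)
  moreover have "rim v1 \<notin> top_of_set Z closure_of W0"
    by (rule not_in_closure_of[OF openin_Z_less[OF continuous_on_const[of Z "1 / 2"] c(1)]])
      (use rim(1)[OF v1(1)] val in \<open>auto simp: W0_def\<close>)
  moreover have "rim v2 \<notin> top_of_set Z closure_of W1"
    by (rule not_in_closure_of[OF openin_Z_less[OF continuous_on_const[of Z "1 / 2"] c(2)]])
      (use rim(1)[OF v2(1)] val in \<open>auto simp: W1_def\<close>)
  ultimately show ?thesis
    using rim(1)[OF v1(1)] rim(1)[OF v2(1)] unfolding standard_open_cover_def by auto
qed

lemma iterated_\<beta>_iff: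
  "C \<in> iterated_cover (top_of_set Z) left_shift \<beta> n \<longleftrightarrow>
    (\<exists>A\<subseteq>{..<n}. C = {z \<in> Z. \<forall>i<n. norm (z (int i)) \<ge> 1 / 2 \<longrightarrow> (address z (int i) = 1 \<longleftrightarrow> i \<in> A)})"
proof -
  have eq: "topspace (top_of_set Z) \<inter> (\<Inter>i<n. (left_shift ^^ i) -` f i) =
      {z \<in> Z. \<forall>i<n. norm (z (int i)) \<ge> 1 / 2 \<longrightarrow> (address z (int i) = 1 \<longleftrightarrow> i \<in> A)}"
    if "\<forall>i<n. f i = (if i \<in> A then W1 else W0)" for f A
  proof -
    have "(left_shift ^^ i) z \<in> f i \<longleftrightarrow> (norm (z (int i)) \<ge> 1 / 2 \<longrightarrow> (address z (int i) = 1 \<longleftrightarrow> i \<in> A))"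
      if "i < n" "z \<in> Z" for i z
      using that shift_in_W[OF that(2), of i] \<open>\<forall>i<n. f i = (if i \<in> A then W1 else W0)\<close> by auto
    then show ?thesis by auto
  qed
  show ?thesis
  proof
    assume "C \<in> iterated_cover (top_of_set Z) left_shift \<beta> n"
    then obtain f where f: "\<forall>i<n. f i \<in> \<beta>" "C = topspace (top_of_set Z) \<inter> (\<Inter>i<n. (left_shift ^^ i) -` f i)"
      unfolding iterated_cover_def by blast
    define A where "A = {i. i < n \<and> f i = W1}"
    have "\<forall>i<n. f i = (if i \<in> A then W1 else W0)" using f(1) by (auto simp: A_def)
    moreover have "A \<subseteq> {..<n}" by (auto simp: A_def)
    ultimately show "\<exists>A\<subseteq>{..<n}. C = {z \<in> Z. \<forall>i<n. norm (z (int i)) \<ge> 1 / 2 \<longrightarrow> (address z (int i) = 1 \<longleftrightarrow> i \<in> A)}"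
      using eq[of f A] f(2) by blast
  next
    assume "\<exists>A\<subseteq>{..<n}. C = {z \<in> Z. \<forall>i<n. norm (z (int i)) \<ge> 1 / 2 \<longrightarrow> (address z (int i) = 1 \<longleftrightarrow> i \<in> A)}"
    then obtain A where "C = {z \<in> Z. \<forall>i<n. norm (z (int i)) \<ge> 1 / 2 \<longrightarrow> (address z (int i) = 1 \<longleftrightarrow> i \<in> A)}" by blast
    then show "C \<in> iterated_cover (top_of_set Z) left_shift \<beta> n"
      unfolding iterated_cover_def using eq[of "\<lambda>i. if i \<in> A then W1 else W0" A]
      by (intro CollectI exI[of _ "\<lambda>i. if i \<in> A then W1 else W0"]) auto
  qed
qed

lemma Y_word: "y \<in> Y \<Longrightarrow> \<exists>v\<in>reg. \<forall>i<n. cod v (int i) = y (int i)"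
proof -
  assume "y \<in> Y"
  then obtain v where "v \<in> reg" "\<forall>m\<in>int ` {..<n}. cod v m = y m"
    unfolding Y_iff by (meson finite_imageI finite_lessThan)
  then show ?thesis by auto
qed

end

section \<open>The cover has zero mean dimension\<close>

lemma integral_vector_norm_less_1:
  fixes u :: "real ^ 'd::finite"
  assumes "\<And>i. u $ i \<in> \<int>" "norm u < 1"
  shows "u = 0"
proof -
  have "u $ i = 0" for i
  proof -
    have "\<bar>u $ i\<bar> < 1" using component_le_norm_cart[of u i] assms(2) by linarith
    then show ?thesis using assms(1)[of i] by (auto elim!: Ints_cases)
  qed
  then show ?thesis by (simp add: vec_eq_iff)
qed

text \<open>The set of centres of \<open>\<delta>\<close>-balls inside \<open>C\<close> is an intersection of translates of \<open>C\<close>.\<close>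

lemma convex_erosion:
  fixes C :: "'a::real_normed_vector set"
  assumes "convex C"
  shows "convex {x. cball x \<delta> \<subseteq> C}"
proof -
  have "{x. cball x \<delta> \<subseteq> C} = (\<Inter>u\<in>cball 0 \<delta>. (\<lambda>x. - u + x) ` C)"
  proof (intro equalityI subsetI)
    fix x assume x: "x \<in> {x. cball x \<delta> \<subseteq> C}"
    have "x \<in> (\<lambda>x. - u + x) ` C" if "u \<in> cball 0 \<delta>" for u
      using x that by (intro image_eqI[of _ _ "x + u"]) (auto simp: dist_norm subset_iff)
    then show "x \<in> (\<Inter>u\<in>cball 0 \<delta>. (\<lambda>x. - u + x) ` C)" by blast
  next
    fix x assume x: "x \<in> (\<Inter>u\<in>cball 0 \<delta>. (\<lambda>x. - u + x) ` C)"
    have "y \<in> C" if "y \<in> cball x \<delta>" for y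
    proof -
      have "y - x \<in> cball 0 \<delta>" using that by (simp add: dist_norm norm_minus_commute)
      then have "x \<in> (\<lambda>z. - (y - x) + z) ` C" using x by blast
      then show ?thesis by auto
    qed
    then show "x \<in> {x. cball x \<delta> \<subseteq> C}" by blast
  qed
  then show ?thesis using assms by (auto intro!: convex_INT convex_translation)
qed

text \<open>The points whose coordinates differ from those of \<open>q / g\<close>, modulo integers, by less than \<open>1 / g\<close>: the
  lift of a small open cube of the torus.\<close>

definition periodic_cube :: "nat \<Rightarrow> ('d::finite \<Rightarrow> int) \<Rightarrow> (real ^ 'd) set" where
  "periodic_cube g q = {x. \<forall>l. \<exists>N::int. \<bar>x $ l - of_int (q l) / real g - of_int N\<bar> < 1 / real g}"

lemma open_periodic_cube: "open (periodic_cube g q :: (real ^ 'd::finite) set)"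
proof -
  have "periodic_cube g q = (\<Inter>l. \<Union>N. {x :: real ^ 'd. \<bar>x $ l - of_int (q l) / real g - of_int N\<bar> < 1 / real g})"
    by (auto simp: periodic_cube_def)
  moreover have "open {x :: real ^ 'd. \<bar>x $ l - of_int (q l) / real g - of_int N\<bar> < 1 / real g}" for l and N :: int
    by (intro open_Collect_less continuous_intros)
  ultimately show ?thesis by (auto intro!: open_INT open_UN)
qed

lemma periodic_cube_proj:
  assumes "torus_proj x = torus_proj y" "x \<in> periodic_cube g q"
  shows "y \<in> periodic_cube g q"
  unfolding periodic_cube_def
proof safe
  fix l
  obtain N where N: "\<bar>x $ l - of_int (q l) / real g - of_int N\<bar> < 1 / real g"
    using assms(2) by (auto simp: periodic_cube_def)
  obtain K where K: "x $ l - y $ l = of_int K" using assms(1) by (auto simp: torus_proj_eq_iff elim: Ints_cases)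
  have "y $ l - of_int (q l) / real g - of_int (N - K) = x $ l - of_int (q l) / real g - of_int N"
    using K by simp
  then show "\<exists>N::int. \<bar>y $ l - of_int (q l) / real g - of_int N\<bar> < 1 / real g"
    using N by (intro exI[of _ "N - K"]) simp
qed

lemma periodic_cube_iff:
  assumes g: "g > 0"
  shows "x \<in> periodic_cube g q \<longleftrightarrow> (\<forall>l. \<exists>N::int. \<bar>real g * x $ l - of_int (q l + int g * N)\<bar> < 1)"
proof -
  have "\<bar>x $ l - of_int (q l) / real g - of_int N\<bar> < 1 / real g \<longleftrightarrow>
    \<bar>real g * x $ l - of_int (q l + int g * N)\<bar> < 1" for l and N :: int
  proof -
    have "\<bar>real g * x $ l - of_int (q l + int g * N)\<bar> = real g * \<bar>x $ l - of_int (q l) / real g - of_int N\<bar>"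
      using g by (simp add: field_simps flip: abs_mult_pos)
    then show ?thesis using g by (simp add: field_simps)
  qed
  then show ?thesis by (simp add: periodic_cube_def)
qed

lemma periodic_cube_cover:
  assumes g: "g > 0"
  shows "\<exists>q\<in>UNIV \<rightarrow>\<^sub>E {0..<int g}. x \<in> periodic_cube g q"
proof
  let ?q = "\<lambda>l. \<lfloor>real g * x $ l\<rfloor> mod int g"
  show "?q \<in> UNIV \<rightarrow>\<^sub>E {0..<int g}" using g by auto
  have "\<bar>real g * x $ l - of_int (?q l + int g * (\<lfloor>real g * x $ l\<rfloor> div int g))\<bar> < 1" for l
  proof -
    have "?q l + int g * (\<lfloor>real g * x $ l\<rfloor> div int g) = \<lfloor>real g * x $ l\<rfloor>" by simp
    then show ?thesis by (simp only:) linarith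
  qed
  then show "x \<in> periodic_cube g ?q" unfolding periodic_cube_iff[OF g] by blast
qed

text \<open>An open interval of length \<open>2\<close> contains at most two integers.\<close>

lemma card_periodic_cubes_le:
  fixes x :: "real ^ 'd::finite"
  assumes g: "g > 0"
  shows "card {q \<in> UNIV \<rightarrow>\<^sub>E {0..<int g}. x \<in> periodic_cube g q} \<le> 2 ^ CARD('d)"
    and "finite {q \<in> UNIV \<rightarrow>\<^sub>E {0..<int g}. x \<in> periodic_cube g q}"
proof -
  define T where "T l = {\<lfloor>real g * x $ l\<rfloor> mod int g, (\<lfloor>real g * x $ l\<rfloor> + 1) mod int g}" for l
  have sub: "{q \<in> UNIV \<rightarrow>\<^sub>E {0..<int g}. x \<in> periodic_cube g q} \<subseteq> PiE UNIV T"
  proof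
    fix q assume "q \<in> {q \<in> UNIV \<rightarrow>\<^sub>E {0..<int g}. x \<in> periodic_cube g q}"
    then have q: "\<And>l. q l \<in> {0..<int g}" "x \<in> periodic_cube g q" by auto
    have "q l \<in> T l" for l
    proof -
      obtain N :: int where N: "\<bar>real g * x $ l - of_int (q l + int g * N)\<bar> < 1"
        using q(2) unfolding periodic_cube_iff[OF g] by blast
      define u where "u = q l + int g * N"
      have "u = \<lfloor>real g * x $ l\<rfloor> \<or> u = \<lfloor>real g * x $ l\<rfloor> + 1"
        using N unfolding u_def[symmetric] by linarith
      moreover have "q l = u mod int g" using q(1)[of l] by (simp add: u_def)
      ultimately show ?thesis by (auto simp: T_def)
    qed
    then show "q \<in> PiE UNIV T" by auto
  qed
  have fT: "finite (T l)" for l by (simp add: T_def)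
  have fin: "finite (PiE UNIV T)" by (intro finite_PiE) (auto simp: fT)
  have "card (PiE UNIV T) = (\<Prod>l\<in>UNIV. card (T l))" by (intro card_PiE) simp
  also have "\<dots> \<le> (\<Prod>l\<in>(UNIV::'d set). 2)"
    by (intro prod_mono) (auto simp: T_def card_insert_if)
  finally have "card (PiE UNIV T) \<le> 2 ^ CARD('d)" by simp
  then show "card {q \<in> UNIV \<rightarrow>\<^sub>E {0..<int g}. x \<in> periodic_cube g q} \<le> 2 ^ CARD('d)"
    using card_mono[OF fin sub] by linarith
  show "finite {q \<in> UNIV \<rightarrow>\<^sub>E {0..<int g}. x \<in> periodic_cube g q}"
    using sub fin finite_subset by blast
qed

lemma periodic_cube_near:
  fixes x :: "real ^ 'd::finite"
  assumes "x \<in> periodic_cube g q" "g > 0" "real CARD('d) / real g < \<delta>"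
  shows "\<exists>y \<in> ball x \<delta>. torus_proj y = torus_proj (\<chi> l. of_int (q l) / real g)"
proof -
  obtain N where N: "\<And>l. \<bar>x $ l - of_int (q l) / real g - of_int (N l)\<bar> < 1 / real g"
    using assms(1) unfolding periodic_cube_def mem_Collect_eq by metis
  define y :: "real ^ 'd" where "y = (\<chi> l. of_int (q l) / real g + of_int (N l))"
  have "norm (x - y) \<le> (\<Sum>l\<in>UNIV. \<bar>(x - y) $ l\<bar>)" by (rule norm_le_l1_cart)
  also have "\<dots> \<le> (\<Sum>l\<in>(UNIV::'d set). 1 / real g)"
    by (intro sum_mono) (use N in \<open>auto simp: y_def diff_diff_eq less_imp_le\<close>)
  also have "\<dots> < \<delta>" using assms(3) by simp
  finally have "y \<in> ball x \<delta>" by (simp add: dist_norm)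
  moreover have "torus_proj y = torus_proj (\<chi> l. of_int (q l) / real g)"
    by (simp add: torus_proj_eq_iff y_def)
  ultimately show ?thesis by blast
qed

lemma finite_representatives:
  assumes "finite (f ` A)"
  shows "\<exists>S\<subseteq>A. finite S \<and> (\<forall>v\<in>A. \<exists>w\<in>S. f w = f v)"
  using finite_subset_image[OF assms subset_refl] by (metis image_iff)

context rotation_coding
begin

lemma P'_diam: "i \<in> {1..k} \<Longrightarrow> x \<in> P' i \<Longrightarrow> y \<in> P' i \<Longrightarrow> norm (x - y) < 1 / 2"
  using P'[of i] diameter_bounded_bound[of "P' i" x y] compact_imp_bounded[of "P' i"]
  by (simp add: dist_norm)

lemma P'_interior_proj: "i \<in> {1..k} \<Longrightarrow> x \<in> interior (P' i) \<Longrightarrow> torus_proj x \<in> U i"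
proof -
  assume i: "i \<in> {1..k}" and x: "x \<in> interior (P' i)"
  have "open (torus_proj ` interior (P' i))" by (intro open_torus_proj_image) auto
  moreover have "torus_proj ` interior (P' i) \<subseteq> closure (U i)" using P'[OF i] interior_subset by blast
  ultimately have "torus_proj ` interior (P' i) \<subseteq> U i" using U_regular[OF i] interior_maximal by blast
  then show ?thesis using x by blast
qed

text \<open>A point of a ball of radius \<open>1/2\<close> around \<open>x\<close> and a point of \<open>P'\<^sub>i\<close> with the same image in the torus differ
  by an integral vector of norm less than \<open>1\<close>, so they are equal.\<close>

lemma P'_proj_interior:
  assumes i: "i \<in> {1..k}" and x: "x \<in> P' i" "torus_proj x \<in> U i"
  shows "x \<in> interior (P' i)"
proof -
  have "open (torus_proj -` U i)" using U_open[OF i] by (simp add: open_torus_iff)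
  then obtain r where r: "r > 0" "ball x r \<subseteq> torus_proj -` U i" using x(2) open_contains_ball by blast
  have "ball x (min r (1/2)) \<subseteq> P' i"
  proof
    fix y assume y: "y \<in> ball x (min r (1/2))"
    then have "torus_proj y \<in> U i" using r by auto
    then have "torus_proj y \<in> closure (U i)" using closure_subset by blast
    then obtain w where w: "w \<in> P' i" "torus_proj y = torus_proj w" using P'[OF i] by blast
    have "norm (y - w) \<le> norm (y - x) + norm (x - w)" using norm_triangle_ineq[of "y - x" "x - w"] by simp
    also have "\<dots> < 1" using y P'_diam[OF i x(1) w(1)] by (simp add: dist_norm norm_minus_commute)
    finally have "y - w = 0"
      using w(2) by (intro integral_vector_norm_less_1) (auto simp: torus_proj_eq_iff)
    then show "y \<in> P' i" using w by simp
  qed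
  then show ?thesis using r(1) by (meson centre_in_ball interiorI min_less_iff_conj open_ball zero_less_divide_1_iff zero_less_numeral)
qed

text \<open>The lift of \<open>v\<close> that the rotation by \<open>m * a\<close> brings to the convex set of the symbol at time \<open>m\<close>.\<close>

definition lift :: "'d torus \<Rightarrow> int \<Rightarrow> real ^ 'd" where
  "lift v m = (SOME x. x \<in> P' (cod v m) \<and> torus_proj x = R m v) - of_int m *\<^sub>R a"

lemma lift:
  assumes "v \<in> reg"
  shows "lift v m + of_int m *\<^sub>R a \<in> interior (P' (cod v m))" "torus_proj (lift v m) = v"
proof -
  have c: "cod v m \<in> {1..k}" "R m v \<in> U (cod v m)" using cod_in[OF assms] by auto
  then have "R m v \<in> torus_proj ` P' (cod v m)" using P'[OF c(1)] closure_subset by blast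
  then have "\<exists>x. x \<in> P' (cod v m) \<and> torus_proj x = R m v" by auto
  from someI_ex[OF this] have l: "lift v m + of_int m *\<^sub>R a \<in> P' (cod v m)"
    "torus_proj (lift v m + of_int m *\<^sub>R a) = R m v" by (auto simp: lift_def)
  then show "lift v m + of_int m *\<^sub>R a \<in> interior (P' (cod v m))"
    using P'_proj_interior[OF c(1)] c(2) by simp
  have "R (- m) (torus_proj (lift v m + of_int m *\<^sub>R a)) = R (- m) (R m v)" using l(2) by simp
  then show "torus_proj (lift v m) = v" by simp
qed

text \<open>The difference of both sides is integral, and its norm is less than \<open>1\<close> because both convex sets have
  diameter less than \<open>1/2\<close>.  Hence changing the reference time changes the lifts of all points with
  the same symbols at both times by one integral vector, and convex combinations of lifts give the
  same point of the torus for both reference times.\<close>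

lemma lift_difference:
  assumes v: "v \<in> reg" "v' \<in> reg" and m: "cod v m = cod v' m" "cod v m' = cod v' m'"
  shows "lift v m - lift v m' = lift v' m - lift v' m'"
proof -
  let ?u = "(lift v m - lift v' m) - (lift v m' - lift v' m')"
  have d: "norm (lift v j - lift v' j) < 1 / 2" if "cod v j = cod v' j" for j
    using P'_diam[of "cod v j" "lift v j + of_int j *\<^sub>R a" "lift v' j + of_int j *\<^sub>R a"]
      lift(1)[OF v(1), of j] lift(1)[OF v(2), of j] that interior_subset cod_in[OF v(1), of j] by auto
  have "norm ?u \<le> norm (lift v m - lift v' m) + norm (lift v m' - lift v' m')" by (rule norm_triangle_ineq4)
  then have "norm ?u < 1" using d[OF m(1)] d[OF m(2)] by simp
  moreover have "?u $ i \<in> \<int>" for i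
  proof -
    have "lift v m $ i - lift v m' $ i \<in> \<int>" "lift v' m $ i - lift v' m' $ i \<in> \<int>"
      using lift(2)[OF v(1)] lift(2)[OF v(2)] by (metis torus_proj_eq_iff)+
    then have "(lift v m $ i - lift v m' $ i) - (lift v' m $ i - lift v' m' $ i) \<in> \<int>" by (rule Ints_diff)
    then show ?thesis by (simp add: algebra_simps)
  qed
  ultimately have "?u = 0" by (intro integral_vector_norm_less_1)
  then show ?thesis by (simp add: algebra_simps)
qed

text \<open>Positive if the coding of \<open>v\<close> agrees with \<open>z\<close> on \<open>[0, n)\<close>, and \<open>0\<close> as soon as they disagree there at a coordinate whose
  radius is at least \<open>1/3\<close>.\<close>

definition weight :: "nat \<Rightarrow> 'd torus \<Rightarrow> (int \<Rightarrow> real ^ 2) \<Rightarrow> real" where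
  "weight n v z = (\<Prod>i<n. max 0 (1 - 3 * (norm (z (int i)) - spoke_coord (cod v (int i)) (z (int i)))))"

lemma weight:
  assumes "v \<in> reg" "z \<in> Z"
  shows "0 \<le> weight n v z"
    and "(\<And>i. i < n \<Longrightarrow> cod v (int i) = address z (int i)) \<Longrightarrow> 0 < weight n v z"
    and "weight n v z \<noteq> 0 \<Longrightarrow> i < n \<Longrightarrow> norm (z (int i)) \<ge> 1 / 3 \<Longrightarrow> cod v (int i) = address z (int i)"
proof -
  have sc: "spoke_coord (cod v m) (z m) = (if address z m = cod v m then norm (z m) else 0)" for m
    using spoke_coord_Z[OF assms(2)] cod_in[OF assms(1)] by blast
  show "0 \<le> weight n v z" unfolding weight_def by (intro prod_nonneg) auto
  show "0 < weight n v z" if "\<And>i. i < n \<Longrightarrow> cod v (int i) = address z (int i)"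
    unfolding weight_def sc using that by (intro prod_pos) auto
  show "cod v (int i) = address z (int i)" if "weight n v z \<noteq> 0" "i < n" "norm (z (int i)) \<ge> 1 / 3"
  proof -
    have "max 0 (1 - 3 * (norm (z (int i)) - (if address z (int i) = cod v (int i) then norm (z (int i)) else 0))) \<noteq> 0"
      using that(1,2) unfolding weight_def sc by (simp only: prod_zero_iff finite_lessThan) blast
    then show ?thesis using that(3) by (auto split: if_splits)
  qed
qed

lemma continuous_weight: "continuous_on S (weight n v)"
  unfolding weight_def[abs_def] by (intro continuous_intros continuous_coordinate)

text \<open>The \<^const>\<open>weight\<close>-average of the lifts of finitely many regular points that realise all words of
  length \<open>n\<close>.  The average depends on a reference time \<open>i\<close> at which \<open>z\<close> is away from the hub, but its
  image in the torus does not.  By convexity it keeps the distance \<open>\<delta>\<close> from the boundary that the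
  lifts of these finitely many points have.\<close>

lemma continuous_section:
  "\<exists>\<delta> s. \<delta> > 0 \<and> (\<forall>m. continuous_on Z (s m)) \<and>
    (\<forall>z\<in>Z. \<forall>i<n. norm (z (int i)) \<ge> 1 / 3 \<longrightarrow>
       cball (s i z + real i *\<^sub>R a) \<delta> \<subseteq> P' (address z (int i)) \<and>
       (\<forall>j<n. norm (z (int j)) \<ge> 1 / 3 \<longrightarrow> torus_proj (s i z) = torus_proj (s j z)))"
proof -
  let ?w = "\<lambda>v. restrict (\<lambda>i. cod v (int i)) {..<n}"
  have "?w ` reg \<subseteq> {..<n} \<rightarrow>\<^sub>E {1..k}"
    using cod_in by (intro image_subsetI) (simp add: restrict_PiE_iff del: atLeastAtMost_iff)
  then have "finite (?w ` reg)" by (rule finite_subset) (auto intro: finite_PiE)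
  from finite_representatives[OF this]
  obtain S where S: "S \<subseteq> reg" "finite S" "\<forall>v\<in>reg. \<exists>v'\<in>S. ?w v' = ?w v"
    by (elim exE conjE)
  define tot where "tot z = (\<Sum>v\<in>S. weight n v z)" for z
  have tot: "0 < tot z" if z: "z \<in> Z" for z
  proof -
    obtain v where v: "v \<in> reg" "\<And>i. i < n \<Longrightarrow> cod v (int i) = address z (int i)"
      using Y_word[OF address(1)[OF z], of n] by blast
    obtain v' where v': "v' \<in> S" "?w v' = ?w v" using bspec[OF S(3) v(1)] by (elim bexE)
    have "cod v' (int i) = address z (int i)" if "i < n" for i
      using fun_cong[OF v'(2), of i] v(2) that by simp
    then have "0 < weight n v' z" using weight(2)[OF _ z] v'(1) S(1) by blast
    then show ?thesis unfolding tot_def using S weight(1)[OF _ z] v'(1) by (intro sum_pos2[of _ v']) auto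
  qed
  define c where "c v z = weight n v z / tot z" for v z
  have cc: "continuous_on Z (c v)" for v
  proof -
    have "\<forall>z\<in>Z. tot z \<noteq> 0" using tot by (metis less_irrefl)
    moreover have "continuous_on Z tot"
      unfolding tot_def[abs_def] by (intro continuous_on_sum continuous_weight)
    ultimately show ?thesis
      unfolding c_def[abs_def] by (intro continuous_on_divide continuous_weight)
  qed
  have c_nn: "0 \<le> c v z" if "v \<in> S" "z \<in> Z" for v z
    using weight(1) tot that S(1) by (auto simp: c_def less_imp_le)
  have c_sum: "(\<Sum>v\<in>S. c v z) = 1" if "z \<in> Z" for z
    using tot[OF that] by (simp add: c_def tot_def flip: sum_divide_distrib)
  have c_pos: "cod v (int i) = address z (int i)"
    if "v \<in> S" "z \<in> Z" "c v z \<noteq> 0" "i < n" "norm (z (int i)) \<ge> 1 / 3" for v z i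
    using weight(3)[of v z n i] that S(1) by (auto simp: c_def)
  have "\<exists>\<delta>>0. \<forall>v\<in>S. \<forall>i<n. cball (lift v (int i) + real i *\<^sub>R a) \<delta> \<subseteq> P' (cod v (int i))"
  proof -
    have "\<exists>\<delta>>0. cball (lift v (int i) + real i *\<^sub>R a) \<delta> \<subseteq> P' (cod v (int i))" if "v \<in> S" for v i
      using lift(1)[of v "int i"] that S(1) mem_interior_cball by auto
    then obtain D where D: "\<And>v i. v \<in> S \<Longrightarrow> D v i > 0 \<and> cball (lift v (int i) + real i *\<^sub>R a) (D v i) \<subseteq> P' (cod v (int i))"
      by metis
    define \<delta> where "\<delta> = Min (insert 1 ((\<lambda>(v, i). D v i) ` (S \<times> {..<n})))"
    have fin: "finite (insert 1 ((\<lambda>(v, i). D v i) ` (S \<times> {..<n})))" using S(2) by auto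
    have "\<delta> > 0" unfolding \<delta>_def using fin D by (subst Min_gr_iff) auto
    moreover have "\<delta> \<le> D v i" if "v \<in> S" "i < n" for v i
      unfolding \<delta>_def using fin that by (intro Min_le) auto
    ultimately show ?thesis using D by (intro exI[of _ \<delta>]) (meson order_trans subset_cball)
  qed
  then obtain \<delta> where \<delta>: "\<delta> > 0" "\<And>v i. v \<in> S \<Longrightarrow> i < n \<Longrightarrow> cball (lift v (int i) + real i *\<^sub>R a) \<delta> \<subseteq> P' (cod v (int i))"
    by blast
  define s where "s i z = (\<Sum>v\<in>S. c v z *\<^sub>R lift v (int i))" for i z
  show ?thesis
  proof (intro exI[of _ \<delta>] exI[of _ s] conjI allI ballI impI)
    show "\<delta> > 0" by fact
    show "continuous_on Z (s i)" for i
      unfolding s_def[abs_def] by (intro continuous_on_sum continuous_on_scaleR continuous_on_const cc)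
  next
    fix z i assume z: "z \<in> Z" and i: "i < n" "norm (z (int i)) \<ge> 1 / 3"
    \<comment> \<open>Weights of points whose word disagrees with \<open>z\<close> vanish, so only points of \<open>?S\<close> contribute.\<close>
    let ?K = "{x. cball x \<delta> \<subseteq> P' (address z (int i))}"
    let ?S = "{v \<in> S. c v z \<noteq> 0}"
    have "(\<Sum>v\<in>?S. c v z) = (\<Sum>v\<in>S. c v z)"
      by (rule sum.mono_neutral_left[OF S(2)]) blast+
    then have sumS: "(\<Sum>v\<in>?S. c v z) = 1" using c_sum[OF z] by (rule trans)
    have ss: "s j z = (\<Sum>v\<in>?S. c v z *\<^sub>R lift v (int j))" for j
      unfolding s_def by (rule sum.mono_neutral_right[OF S(2)]) (blast, simp)
    have wc: "(\<Sum>v\<in>?S. c v z *\<^sub>R x) = x" for x :: "real ^ 'd"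
      by (simp only: scaleR_sum_left[symmetric] sumS scaleR_one)
    have "s i z + real i *\<^sub>R a = (\<Sum>v\<in>?S. c v z *\<^sub>R (lift v (int i) + real i *\<^sub>R a))"
      by (simp only: ss scaleR_add_right sum.distrib wc)
    also have "\<dots> \<in> ?K"
    proof (rule convex_sum)
      show "finite ?S" using S(2) by simp
      show "convex ?K" using P'[OF address_range[OF z]] by (intro convex_erosion) auto
      show "(\<Sum>v\<in>?S. c v z) = 1" by (rule sumS)
      show "0 \<le> c v z" if "v \<in> ?S" for v using c_nn z that by auto
      show "lift v (int i) + real i *\<^sub>R a \<in> ?K" if "v \<in> ?S" for v
        using \<delta>(2)[of v i] c_pos[of v z i] that i z by auto
    qed
    finally show "cball (s i z + real i *\<^sub>R a) \<delta> \<subseteq> P' (address z (int i))" by simp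
    fix j assume j: "j < n" "norm (z (int j)) \<ge> 1 / 3"
    have "?S \<noteq> {}"
    proof
      assume "?S = {}"
      then show False using sumS by (simp only:) simp
    qed
    then obtain v0 where v0: "v0 \<in> ?S" by blast
    have "s i z - s j z = (\<Sum>v\<in>?S. c v z *\<^sub>R (lift v (int i) - lift v (int j)))"
      by (simp add: ss sum_subtractf scaleR_diff_right)
    also have "\<dots> = (\<Sum>v\<in>?S. c v z *\<^sub>R (lift v0 (int i) - lift v0 (int j)))"
    proof (rule sum.cong[OF refl])
      fix v assume v: "v \<in> ?S"
      have "lift v (int i) - lift v (int j) = lift v0 (int i) - lift v0 (int j)"
        using v v0 S(1) c_pos[OF _ z _ i] c_pos[OF _ z _ j] by (intro lift_difference) auto
      then show "c v z *\<^sub>R (lift v (int i) - lift v (int j)) = c v z *\<^sub>R (lift v0 (int i) - lift v0 (int j))" by simp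
    qed
    also have "\<dots> = lift v0 (int i) - lift v0 (int j)"
      by (rule wc)
    finally have "s i z - s j z = lift v0 (int i) - lift v0 (int j)" .
    moreover have "torus_proj (lift v0 (int i)) = torus_proj (lift v0 (int j))"
      using lift(2)[of v0] v0 S(1) by auto
    ultimately show "torus_proj (s i z) = torus_proj (s j z)"
      unfolding torus_proj_eq_iff by (metis vector_minus_component)
  qed
qed

text \<open>The refinement consists of the set \<open>A\<close> of points that are near the hub at all times below \<open>n\<close> and of
  the preimages \<open>G q\<close> of small cubes of the torus under the section.  The points of \<open>G q\<close> have a common
  word: at every time at which such a point is far out, its symbol is that of the centre of the cube,
  because the section stays away from the boundary of the pieces by more than the size of the cube.
  Each point of the torus lies in at most \<open>2\<^sup>d\<close> of the cubes.\<close>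

lemma cover_dim_\<beta>_le:
  "cover_dim (top_of_set Z) (iterated_cover (top_of_set Z) left_shift \<beta> n) \<le> 2 ^ CARD('d)"
proof -
  obtain \<delta> s where \<delta>: "\<delta> > 0" and cs: "\<And>m. continuous_on Z (s m)"
    and s_ball: "\<And>z i. z \<in> Z \<Longrightarrow> i < n \<Longrightarrow> norm (z (int i)) \<ge> 1 / 3 \<Longrightarrow>
       cball (s i z + real i *\<^sub>R a) \<delta> \<subseteq> P' (address z (int i))"
    and s_proj: "\<And>z i j. z \<in> Z \<Longrightarrow> i < n \<Longrightarrow> norm (z (int i)) \<ge> 1 / 3 \<Longrightarrow> j < n \<Longrightarrow>
       norm (z (int j)) \<ge> 1 / 3 \<Longrightarrow> torus_proj (s i z) = torus_proj (s j z)"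
    using continuous_section[of n] by metis
  obtain g :: nat where "real CARD('d) / \<delta> < real g" using reals_Archimedean2 by blast
  moreover from this have g: "g > 0" using \<delta> by (auto intro!: gr0I simp: field_simps)
  ultimately have g\<delta>: "real CARD('d) / real g < \<delta>" using \<delta> by (simp add: field_simps)
  define Qs where "Qs = ((UNIV :: 'd set) \<rightarrow>\<^sub>E {0..<int g})"
  have fQs: "finite Qs" by (auto simp: Qs_def intro: finite_PiE)
  define G where "G q = {z \<in> Z. \<exists>i<n. 1 / 3 < norm (z (int i)) \<and> s i z \<in> periodic_cube g q}" for q
  define A where "A = {z \<in> Z. \<forall>i<n. norm (z (int i)) < 1 / 2}"
  have oA: "openin (top_of_set Z) A"
  proof -
    have "openin (top_of_set Z) ((\<Inter>i<n. {z \<in> Z. norm (z (int i)) < 1 / 2}) \<inter> topspace (top_of_set Z))"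
      by (intro openin_INT finite_lessThan openin_Z_less continuous_intros continuous_coordinate)
    moreover have "A = (\<Inter>i<n. {z \<in> Z. norm (z (int i)) < 1 / 2}) \<inter> topspace (top_of_set Z)"
      by (auto simp: A_def)
    ultimately show ?thesis by simp
  qed
  have oG: "openin (top_of_set Z) (G q)" for q
  proof -
    have "G q = (\<Union>i<n. {z \<in> Z. 1 / 3 < norm (z (int i))} \<inter> (Z \<inter> s i -` periodic_cube g q))"
      by (auto simp: G_def)
    moreover have "openin (top_of_set Z) {z \<in> Z. 1 / 3 < norm (z (int i))}" for i
      by (intro openin_Z_less continuous_intros continuous_coordinate)
    moreover have "openin (top_of_set Z) (Z \<inter> s i -` periodic_cube g q)" for i
      by (intro continuous_openin_preimage_gen cs open_periodic_cube)
    ultimately show ?thesis by (simp only:) (blast intro: openin_Union openin_Int)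
  qed
  show ?thesis
  proof (rule cover_dim_leI)
    show "topspace (top_of_set Z) \<noteq> {}" using Z_nonempty by simp
    have "\<exists>C\<in>insert A (G ` Qs). z \<in> C" if z: "z \<in> Z" for z
    proof (cases "z \<in> A")
      case False
      then obtain i where i: "i < n" "norm (z (int i)) \<ge> 1 / 2" using z by (auto simp: A_def not_less)
      obtain q where "q \<in> Qs" "s i z \<in> periodic_cube g q"
        using periodic_cube_cover[OF g] unfolding Qs_def by blast
      then have "z \<in> G q" using z i by (auto simp: G_def intro!: exI[of _ i])
      then show ?thesis using \<open>q \<in> Qs\<close> by blast
    qed auto
    then have "\<Union>(insert A (G ` Qs)) = Z" by (auto simp: A_def G_def)
    then show "finite_open_cover (top_of_set Z) (insert A (G ` Qs))"
      using oA oG fQs by (auto simp: finite_open_cover_def)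
    show "refines (insert A (G ` Qs)) (iterated_cover (top_of_set Z) left_shift \<beta> n)"
      unfolding refines_def
    proof
      fix C assume "C \<in> insert A (G ` Qs)"
      then consider "C = A" | q where "C = G q" by blast
      then show "\<exists>D\<in>iterated_cover (top_of_set Z) left_shift \<beta> n. C \<subseteq> D"
      proof cases
        case 1
        have "C \<subseteq> {z \<in> Z. \<forall>i<n. norm (z (int i)) \<ge> 1 / 2 \<longrightarrow> (address z (int i) = 1 \<longleftrightarrow> i \<in> {})}"
          unfolding 1 A_def by fastforce
        then show ?thesis unfolding Bex_def iterated_\<beta>_iff by blast
      next
        case 2
        define u where "u = torus_proj (\<chi> l. of_int (q l) / real g :: real ^ 'd)"
        define B where "B = {i. i < n \<and> R (int i) u \<in> U 1}"
        have "address z (int i) = 1 \<longleftrightarrow> i \<in> B"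
          if z: "z \<in> C" and i: "i < n" "norm (z (int i)) \<ge> 1 / 2" for z i
        proof -
          have zZ: "z \<in> Z" using z 2 by (auto simp: G_def)
          obtain j where j: "j < n" "1 / 3 < norm (z (int j))" "s j z \<in> periodic_cube g q"
            using z 2 by (auto simp: G_def)
          have "s i z \<in> periodic_cube g q"
            using s_proj[OF zZ j(1) _ i(1)] j i by (intro periodic_cube_proj[OF _ j(3)]) auto
          then obtain x where x: "x \<in> ball (s i z) \<delta>" "torus_proj x = u"
            using periodic_cube_near[OF _ g g\<delta>] unfolding u_def by blast
          have "x + real i *\<^sub>R a \<in> ball (s i z + real i *\<^sub>R a) \<delta>" using x(1) by (simp add: dist_norm)
          moreover have "ball (s i z + real i *\<^sub>R a) \<delta> \<subseteq> interior (P' (address z (int i)))"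
            using s_ball[OF zZ i(1)] i(2) ball_subset_cball by (intro interior_maximal) (auto simp: subset_iff)
          ultimately have "torus_proj (x + real i *\<^sub>R a) \<in> U (address z (int i))"
            using P'_interior_proj[OF address_range[OF zZ]] by blast
          then have Ri: "R (int i) u \<in> U (address z (int i))" using x(2) by (metis of_int_of_nat_eq rotation_proj)
          show ?thesis
            using Ri U_disj[OF address_range[OF zZ] one_in] i(1) by (auto simp: B_def)
        qed
        then have "C \<subseteq> {z \<in> Z. \<forall>i<n. norm (z (int i)) \<ge> 1 / 2 \<longrightarrow> (address z (int i) = 1 \<longleftrightarrow> i \<in> B)}"
          using 2 by (auto simp: G_def)
        moreover have "B \<subseteq> {..<n}" by (auto simp: B_def)
        ultimately show ?thesis unfolding Bex_def iterated_\<beta>_iff by blast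
      qed
    qed
    fix z assume "z \<in> topspace (top_of_set Z)"
    then have z: "z \<in> Z" by simp
    have "\<exists>x. {q \<in> Qs. z \<in> G q} \<subseteq> {q \<in> Qs. x \<in> periodic_cube g q}"
    proof (cases "\<exists>i<n. 1 / 3 < norm (z (int i))")
      case True
      then obtain i where i: "i < n" "1 / 3 < norm (z (int i))" by blast
      have "s i z \<in> periodic_cube g q" if q: "z \<in> G q" for q
      proof -
        obtain j where j: "j < n" "1 / 3 < norm (z (int j))" "s j z \<in> periodic_cube g q"
          using q by (auto simp: G_def)
        show ?thesis using s_proj[OF z j(1) _ i(1)] j i by (intro periodic_cube_proj[OF _ j(3)]) auto
      qed
      then show ?thesis by blast
    next
      case False
      then show ?thesis by (auto simp: G_def)
    qed
    then obtain x where "{q \<in> Qs. z \<in> G q} \<subseteq> {q \<in> Qs. x \<in> periodic_cube g q}" by blast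
    then have "card {q \<in> Qs. z \<in> G q} \<le> 2 ^ CARD('d)"
      using card_periodic_cubes_le[OF g, of x] card_mono unfolding Qs_def by (meson order_trans)
    moreover have "{C \<in> insert A (G ` Qs). z \<in> C} \<subseteq> insert A (G ` {q \<in> Qs. z \<in> G q})" by blast
    then have "card {C \<in> insert A (G ` Qs). z \<in> C} \<le> card (insert A (G ` {q \<in> Qs. z \<in> G q}))"
      using fQs by (intro card_mono) auto
    moreover have "card (insert A (G ` {q \<in> Qs. z \<in> G q})) \<le> card {q \<in> Qs. z \<in> G q} + 1"
      using card_image_le[of "{q \<in> Qs. z \<in> G q}" G] fQs by (simp add: card_insert_if)
    ultimately show "card {C \<in> insert A (G ` Qs). z \<in> C} \<le> 2 ^ CARD('d) + 1" by linarith
  qed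
qed

lemma mdim_\<beta>: "mdim_cover (top_of_set Z) left_shift \<beta> = 0"
proof -
  let ?D = "\<lambda>n. cover_dim (top_of_set Z) (iterated_cover (top_of_set Z) left_shift \<beta> n)"
  have le: "real (?D n) \<le> 2 ^ CARD('d)" for n
    using cover_dim_\<beta>_le[of n] by (simp flip: of_nat_le_iff)
  have "(\<lambda>n. real (?D n) / real n) \<longlonglongrightarrow> 0"
  proof (rule tendsto_sandwich)
    show "\<forall>\<^sub>F n in sequentially. 0 \<le> real (?D n) / real n"
      by (intro always_eventually allI divide_nonneg_nonneg of_nat_0_le_iff)
    show "\<forall>\<^sub>F n in sequentially. real (?D n) / real n \<le> 2 ^ CARD('d) / real n"
      by (intro always_eventually allI divide_right_mono le of_nat_0_le_iff)
    show "(\<lambda>n. 2 ^ CARD('d) / real n) \<longlonglongrightarrow> 0" by (rule lim_const_over_n)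
  qed (rule tendsto_const)
  then show ?thesis unfolding mdim_cover_def by (rule limI)
qed

end

section \<open>Growth of the iterated cover\<close>

text \<open>The integers that bring the \<open>i\<close>-th coordinate of \<open>x\<close> into the box are those between
  \<open>x $ i - u $ i\<close> and \<open>x $ i - l $ i\<close>.\<close>

lemma mem_proj_cbox_iff:
  "torus_proj x \<in> torus_proj ` cbox l u \<longleftrightarrow> (\<forall>i. \<lceil>x $ i - u $ i\<rceil> \<le> \<lfloor>x $ i - l $ i\<rfloor>)"
proof
  assume "torus_proj x \<in> torus_proj ` cbox l u"
  then obtain y where y: "y \<in> cbox l u" "torus_proj x = torus_proj y" by blast
  show "\<forall>i. \<lceil>x $ i - u $ i\<rceil> \<le> \<lfloor>x $ i - l $ i\<rfloor>"
  proof
    fix i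
    obtain N :: int where "x $ i - y $ i = of_int N" using y(2) by (auto simp: torus_proj_eq_iff elim: Ints_cases)
    moreover have "l $ i \<le> y $ i" "y $ i \<le> u $ i" using y(1) by (auto simp: mem_box_cart)
    ultimately have "\<lceil>x $ i - u $ i\<rceil> \<le> N" "N \<le> \<lfloor>x $ i - l $ i\<rfloor>"
      by (auto simp: ceiling_le_iff le_floor_iff)
    then show "\<lceil>x $ i - u $ i\<rceil> \<le> \<lfloor>x $ i - l $ i\<rfloor>" by simp
  qed
next
  assume le: "\<forall>i. \<lceil>x $ i - u $ i\<rceil> \<le> \<lfloor>x $ i - l $ i\<rfloor>"
  define y where "y = (\<chi> i. x $ i - of_int \<lfloor>x $ i - l $ i\<rfloor>)"
  have "l $ i \<le> y $ i \<and> y $ i \<le> u $ i" for i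
  proof -
    have "of_int \<lfloor>x $ i - l $ i\<rfloor> \<le> x $ i - l $ i" by simp
    moreover have "x $ i - u $ i \<le> of_int \<lfloor>x $ i - l $ i\<rfloor>"
      using le by (simp flip: ceiling_le_iff)
    ultimately show ?thesis unfolding y_def vec_lambda_beta by linarith
  qed
  then have "y \<in> cbox l u" by (simp add: mem_box_cart)
  moreover have "torus_proj x = torus_proj y" by (simp add: torus_proj_eq_iff y_def)
  ultimately show "torus_proj x \<in> torus_proj ` cbox l u" by blast
qed

context rotation_coding
begin

text \<open>The word of length \<open>n\<close> of \<open>v\<close> in the coding by \<open>U 1\<close> and its complement, as a set of times.\<close>

definition visits :: "nat \<Rightarrow> 'd torus \<Rightarrow> nat set" where
  "visits n v = {i. i < n \<and> R (int i) v \<in> U 1}"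

lemma visits_subset: "visits n v \<subseteq> {..<n}"
  by (auto simp: visits_def)

lemma finite_visits: "finite (visits n ` S)"
  by (rule finite_subset[of _ "Pow {..<n}"]) (use visits_subset in auto)

text \<open>Let \<open>x\<^sub>0, x\<^sub>1, \<dots>\<close> be lifts in \<open>P'\<^sub>1\<close> of an orbit under the rotation by \<open>P * a\<close> that stays in \<open>U\<^sub>1\<close>.  All
  steps \<open>x\<^bsub>j+1\<^esub> - x\<^sub>j\<close> are shorter than \<open>1/2\<close> and congruent to \<open>P * a\<close>, hence equal; since \<open>P'\<^sub>1\<close> is
  bounded, they vanish, so \<open>P * a\<close> is integral, against the rational independence.\<close>

lemma orbit_leaves_U1:
  assumes "P > 0"
  shows "\<exists>j. R (int (j * P)) v \<notin> U 1"
proof (rule ccontr)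
  assume "\<not> ?thesis"
  then have all: "R (int (j * P)) v \<in> U 1" for j by blast
  have "\<exists>x. x \<in> P' 1 \<and> torus_proj x = R (int (j * P)) v" for j
  proof -
    have "R (int (j * P)) v \<in> torus_proj ` P' 1" using all[of j] P'[OF one_in] closure_subset by blast
    then show ?thesis by auto
  qed
  then obtain x where x: "\<And>j. x j \<in> P' 1" "\<And>j. torus_proj (x j) = R (int (j * P)) v" by metis
  define u where "u j = real P *\<^sub>R a - (x (Suc j) - x j)" for j
  have u_int: "u j $ i \<in> \<int>" for i j
  proof -
    have "torus_proj (x (Suc j)) = rotation (real P *\<^sub>R a) (torus_proj (x j))"
      using x(2)[of j] x(2)[of "Suc j"] by (simp add: algebra_simps)
    then have "x j $ i + real P * a $ i - x (Suc j) $ i \<in> \<int>"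
      by (metis rotation_proj torus_proj_eq_iff vector_add_component vector_scaleR_component real_scaleR_def)
    moreover have "u j $ i = x j $ i + real P * a $ i - x (Suc j) $ i" by (simp add: u_def)
    ultimately show ?thesis by simp
  qed
  have u0: "u j = u 0" for j
  proof -
    have "u j - u 0 = (x (Suc 0) - x 0) - (x (Suc j) - x j)" by (simp add: u_def)
    then have "norm (u j - u 0) \<le> norm (x (Suc 0) - x 0) + norm (x (Suc j) - x j)"
      using norm_triangle_ineq4[of "x (Suc 0) - x 0" "x (Suc j) - x j"] by simp
    also have "\<dots> < 1"
      using P'_diam[OF one_in x(1)[of "Suc 0"] x(1)[of 0]] P'_diam[OF one_in x(1)[of "Suc j"] x(1)[of j]] by simp
    finally have "u j - u 0 = 0"
      using u_int by (intro integral_vector_norm_less_1) (auto intro: Ints_diff)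
    then show ?thesis by simp
  qed
  define w where "w = real P *\<^sub>R a - u 0"
  have step: "x (Suc j) = x j + w" for j
    using u0[of j] by (simp add: u_def w_def algebra_simps)
  have xw: "x j = x 0 + real j *\<^sub>R w" for j
    by (induction j) (auto simp: step algebra_simps)
  have "w = 0"
  proof (rule ccontr)
    assume "w \<noteq> 0"
    obtain j :: nat where "1 / norm w < real j" using reals_Archimedean2 by blast
    then have "1 < norm (x j - x 0)" using \<open>w \<noteq> 0\<close> by (simp add: xw[of j] field_simps)
    then show False using P'_diam[OF one_in x(1)[of j] x(1)[of 0]] by simp
  qed
  then have Pa: "real P *\<^sub>R a = u 0" by (simp add: w_def)
  obtain l :: 'd where True by blast
  obtain K :: int where K: "u 0 $ l = of_int K" using u_int[of 0 l] by (auto elim: Ints_cases)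
  have "real P * a $ l = of_int K" using arg_cong[OF Pa, of "\<lambda>v. v $ l"] K by simp
  then have "of_rat (- of_int K) + (\<Sum>i\<in>UNIV. of_rat (if i = l then of_nat P else 0) * a $ i) = 0"
    by (simp add: of_rat_minus if_distrib[of of_rat] if_distrib[of "\<lambda>x. x * _"] sum.delta cong: if_cong)
  then have "\<forall>i. (if i = l then of_nat P else 0 :: rat) = 0"
    by (rule indep[unfolded rationally_independent_with_one_def, THEN spec[of _ "- of_int K"],
          THEN spec[of _ "\<lambda>i. if i = l then of_nat P else 0"], THEN mp, THEN conjunct2])
  then show False using assms by (auto dest: spec[of _ l])
qed

text \<open>The argument of Morse and Hedlund: if the number of words does not increase from \<open>n\<close> to \<open>n + 1\<close>, a word
  of length \<open>n\<close> determines the entire future.  As there are finitely many words, two points of the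
  backward orbit of some \<open>v \<in> U 1\<close> have the same future, so \<open>v\<close> returns to \<open>U 1\<close> periodically.\<close>

lemma card_visits_Suc:
  assumes "n \<ge> 1"
  shows "card (visits n ` reg) < card (visits (Suc n) ` reg)"
proof (rule ccontr)
  assume "\<not> ?thesis"
  then have le: "card (visits (Suc n) ` reg) \<le> card (visits n ` reg)" by simp
  define t where "t A = A \<inter> {..<n}" for A :: "nat set"
  have t: "t (visits (Suc n) v) = visits n v" for v by (auto simp: t_def visits_def)
  have "t ` visits (Suc n) ` reg = visits n ` reg" by (auto simp: image_image t)
  then have inj: "inj_on t (visits (Suc n) ` reg)"
    using le card_image_le[OF finite_visits, of t "Suc n" reg]
    by (intro eq_card_imp_inj_on finite_visits) simp
  have ext: "visits (Suc n) v = visits (Suc n) v'" if "v \<in> reg" "v' \<in> reg" "visits n v = visits n v'" for v v'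
    using inj that t by (metis image_eqI inj_onD)
  have shift: "visits n (R 1 v) = visits n (R 1 v')" if "v \<in> reg" "v' \<in> reg" "visits n v = visits n v'" for v v'
  proof -
    have "visits n (R 1 v) = {i. Suc i \<in> visits (Suc n) v}" for v
      by (auto simp: visits_def simp flip: scaleR_add_left) (simp_all add: algebra_simps)
    then show ?thesis using ext[OF that] by simp
  qed
  have future: "visits n (R (int i) v) = visits n (R (int i) v')"
    if "v \<in> reg" "v' \<in> reg" "visits n v = visits n v'" for v v' i
  proof (induction i)
    case 0
    then show ?case using that by simp
  next
    case (Suc i)
    have "visits n (R 1 (R (int i) v)) = visits n (R 1 (R (int i) v'))"
      by (rule shift[OF reg_R[OF that(1)] reg_R[OF that(2)] Suc])
    then show ?case by (simp only: R_R of_nat_Suc)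
  qed
  have same: "R (int i) v \<in> U 1 \<longleftrightarrow> R (int i) v' \<in> U 1"
    if "v \<in> reg" "v' \<in> reg" "visits n v = visits n v'" for v v' i
  proof -
    have "0 \<in> visits n w \<longleftrightarrow> w \<in> U 1" for w using assms by (simp add: visits_def)
    then show ?thesis using future[OF that, of i] by blast
  qed
  obtain v where v: "v \<in> reg" "v \<in> U 1" using reg_dense[of "U 1"] U_open[OF one_in] by blast
  have "\<not> inj (\<lambda>s::nat. visits n (R (- int s) v))"
  proof
    assume "inj (\<lambda>s::nat. visits n (R (- int s) v))"
    moreover have "finite (range (\<lambda>s::nat. visits n (R (- int s) v)))"
      by (rule finite_subset[OF _ finite_visits[of n UNIV]]) auto
    ultimately show False using finite_imageD by blast
  qed
  then obtain s s' :: nat where ss: "s \<noteq> s'" "visits n (R (- int s) v) = visits n (R (- int s') v)"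
    by (auto simp: inj_def)
  \<comment> \<open>Both orbits start at or before time \<open>0\<close>, so comparing them shows that visits from time \<open>0\<close> on have period \<open>hi - lo\<close>.\<close>
  define lo hi where "lo = min s s'" and "hi = max s s'"
  have eq: "visits n (R (- int lo) v) = visits n (R (- int hi) v)" and "lo < hi"
    using ss by (auto simp: lo_def hi_def min_def max_def)
  define P where "P = hi - lo"
  have P: "P > 0" "hi = lo + P" using \<open>lo < hi\<close> by (auto simp: P_def)
  have per: "R (int i) v \<in> U 1 \<longleftrightarrow> R (int (i + P)) v \<in> U 1" for i
  proof -
    have "R (int (i + hi)) (R (- int lo) v) \<in> U 1 \<longleftrightarrow> R (int (i + hi)) (R (- int hi) v) \<in> U 1"
      by (rule same[OF reg_R[OF v(1)] reg_R[OF v(1)] eq])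
    moreover have "int (i + hi) + - int lo = int (i + P)" "int (i + hi) + - int hi = int i"
      using P(2) by simp_all
    ultimately show ?thesis by (simp only: R_R)
  qed
  have "R (int (j * P)) v \<in> U 1" for j
  proof (induction j)
    case (Suc j)
    then show ?case using per[of "j * P"] by (simp add: add.commute)
  qed (use v in simp)
  then show False using orbit_leaves_U1[OF P(1)] by blast
qed

lemma card_visits_ge: "n \<ge> 1 \<Longrightarrow> n + 1 \<le> card (visits n ` reg)"
proof (induction n rule: dec_induct)
  case base
  obtain v1 where v1: "v1 \<in> reg" "v1 \<in> U 1" using reg_dense[of "U 1"] U_open[OF one_in] by blast
  obtain v2 where v2: "v2 \<in> reg" "v2 \<in> U 2" using reg_dense[of "U 2"] U_open[OF two_in] by blast
  have "v2 \<notin> U 1" using v2 U_disj[OF one_in two_in] by auto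
  moreover have "0 \<in> visits 1 w \<longleftrightarrow> w \<in> U 1" for w by (simp add: visits_def)
  ultimately have "visits 1 v1 \<noteq> visits 1 v2" using v1(2) by blast
  then have "card {visits 1 v1, visits 1 v2} = 2" unfolding card_2_iff by blast
  moreover have "{visits 1 v1, visits 1 v2} \<subseteq> visits 1 ` reg" using v1(1) v2(1) by blast
  from card_mono[OF finite_visits this] have "card {visits 1 v1, visits 1 v2} \<le> card (visits 1 ` reg)" .
  ultimately show ?case by linarith
next
  case (step n)
  then show ?case using card_visits_Suc[of n] by simp
qed

text \<open>The member with word \<open>visits n v\<close> is the only one that contains \<open>rim v\<close>, and these members suffice to
  cover.\<close>

lemma subcover_number_eq:
  "subcover_number (top_of_set Z) (iterated_cover (top_of_set Z) left_shift \<beta> n) = card (visits n ` reg)"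
proof -
  let ?I = "iterated_cover (top_of_set Z) left_shift \<beta> n"
  let ?S = "{card \<V> |\<V>. \<V> \<subseteq> ?I \<and> finite \<V> \<and> \<Union>\<V> = topspace (top_of_set Z)}"
  define E where "E A = {z \<in> Z. \<forall>i<n. norm (z (int i)) \<ge> 1 / 2 \<longrightarrow> (address z (int i) = 1 \<longleftrightarrow> i \<in> A)}" for A
  have I: "C \<in> ?I \<longleftrightarrow> (\<exists>A\<subseteq>{..<n}. C = E A)" for C
    unfolding iterated_\<beta>_iff E_def ..
  have rimE: "rim v \<in> E A \<longleftrightarrow> A = visits n v" if "v \<in> reg" "A \<subseteq> {..<n}" for v A
  proof -
    have "cod v (int i) = 1 \<longleftrightarrow> R (int i) v \<in> U 1" for i by (rule cod_iff[OF that(1) one_in])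
    then have "rim v \<in> E A \<longleftrightarrow> (\<forall>i<n. i \<in> visits n v \<longleftrightarrow> i \<in> A)"
      unfolding E_def visits_def using rim[OF that(1)] by simp
    also have "\<dots> \<longleftrightarrow> A = visits n v" using that(2) visits_subset[of n v] by blast
    finally show ?thesis .
  qed
  have cov: "\<Union>(E ` visits n ` reg) = Z"
  proof (intro equalityI subsetI)
    fix z assume z: "z \<in> Z"
    obtain v where v: "v \<in> reg" "\<And>i. i < n \<Longrightarrow> cod v (int i) = address z (int i)"
      using Y_word[OF address(1)[OF z], of n] by blast
    have "address z (int i) = 1 \<longleftrightarrow> R (int i) v \<in> U 1" if "i < n" for i
      using cod_iff[OF v(1) one_in, of "int i"] v(2)[OF that] by simp
    then have "z \<in> E (visits n v)" using z by (simp add: E_def visits_def)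
    then show "z \<in> \<Union>(E ` visits n ` reg)" using v(1) by blast
  qed (auto simp: E_def)
  have lower: "card (visits n ` reg) \<le> card \<V>" if \<V>: "\<V> \<subseteq> ?I" "finite \<V>" "\<Union>\<V> = Z" for \<V>
  proof -
    have "E ` visits n ` reg \<subseteq> \<V>"
    proof safe
      fix v assume v: "v \<in> reg"
      then obtain C where C: "C \<in> \<V>" "rim v \<in> C" using \<V>(3) rim(1)[OF v] by blast
      then obtain B where B: "B \<subseteq> {..<n}" "C = E B" using \<V>(1) I by blast
      then have "B = visits n v" using rimE[OF v B(1)] C(2) by simp
      then show "E (visits n v) \<in> \<V>" using C(1) B(2) by simp
    qed
    then have "card (E ` visits n ` reg) \<le> card \<V>" by (rule card_mono[OF \<V>(2)])
    moreover have "inj_on E (visits n ` reg)"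
    proof (rule inj_onI, elim imageE)
      fix A B v v' assume *: "E A = E B" "A = visits n v" "v \<in> reg" "B = visits n v'" "v' \<in> reg"
      then have v: "v \<in> reg" "v' \<in> reg" "E (visits n v) = E (visits n v')" by simp_all
      have "rim v \<in> E (visits n v')" using rimE[OF v(1) visits_subset, of v] v(3) by simp
      then have "visits n v' = visits n v" using rimE[OF v(1) visits_subset] by blast
      then show "A = B" using * by simp
    qed
    ultimately show ?thesis by (simp add: card_image)
  qed
  have "E ` visits n ` reg \<subseteq> ?I" using I visits_subset by blast
  then have mem: "card (E ` visits n ` reg) \<in> ?S"
    using cov finite_visits[of n reg] by (intro CollectI exI[of _ "E ` visits n ` reg"]) simp
  then have "subcover_number (top_of_set Z) ?I \<le> card (E ` visits n ` reg)"
    unfolding subcover_number_def by (rule wellorder_Inf_le1)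
  also have "\<dots> \<le> card (visits n ` reg)" by (rule card_image_le[OF finite_visits])
  finally have "subcover_number (top_of_set Z) ?I \<le> card (visits n ` reg)" .
  moreover have "Inf ?S \<in> ?S" using mem by (intro Inf_nat_def1) blast
  then have "card (visits n ` reg) \<le> subcover_number (top_of_set Z) ?I"
    unfolding subcover_number_def using lower by (elim CollectE exE conjE) simp
  ultimately show ?thesis by simp
qed

text \<open>For \<open>t \<in> [0,1)\<close> the integers \<open>fl i j t\<close> and \<open>ce i j t\<close>, which decide whether time \<open>j\<close> is a visit, are
  monotone in \<open>t\<close> and increase by at most \<open>1\<close>.  The sum \<open>rk\<close> of their increases over all \<open>j < n\<close>
  therefore determines each of them and takes at most \<open>2 * n + 1\<close> values.\<close>

lemma card_visits_le:
  assumes box: "P' 1 = cbox l u"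
  shows "card (visits n ` reg) \<le> (2 * n + 1) ^ CARD('d)"
proof -
  define X :: "'d torus \<Rightarrow> real ^ 'd" where "X v = (\<chi> i. frac (torus_rep v $ i))" for v
  have projX: "torus_proj (X v) = v" for v
  proof -
    have "torus_proj (X v) = torus_proj (torus_rep v)"
      unfolding torus_proj_eq_iff by (simp add: X_def frac_def)
    also have "\<dots> = v" by (rule Quotient3_abs_rep[OF Quotient3_torus])
    finally show ?thesis .
  qed
  have X01: "0 \<le> X v $ i" "X v $ i < 1" for v i by (auto simp: X_def frac_lt_1)
  define fl where "fl i j t = \<lfloor>t + real j * a $ i - l $ i\<rfloor>" for i j t
  define ce where "ce i j t = \<lceil>t + real j * a $ i - u $ i\<rceil>" for i j t
  have mono: "fl i j t \<le> fl i j t'" "ce i j t \<le> ce i j t'" if "t \<le> t'" for i j t t'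
    using that by (auto simp: fl_def ce_def intro!: floor_mono ceiling_mono)
  have up: "fl i j t \<le> fl i j 0 + 1" "ce i j t \<le> ce i j 0 + 1" if "t < 1" for i j t
    using that unfolding fl_def ce_def by linarith+
  define rk where "rk v i = (\<Sum>j<n. (fl i j (X v $ i) - fl i j 0) + (ce i j (X v $ i) - ce i j 0))" for v i
  have rk_range: "rk v \<in> UNIV \<rightarrow>\<^sub>E {0..int (2 * n)}" for v
  proof -
    have "rk v i \<le> (\<Sum>j<n. 2)" for i
      unfolding rk_def
    proof (rule sum_mono)
      show "(fl i j (X v $ i) - fl i j 0) + (ce i j (X v $ i) - ce i j 0) \<le> 2" for j
        using up(1)[OF X01(2), of i j v i] up(2)[OF X01(2), of i j v i] by linarith
    qed
    moreover have "0 \<le> rk v i" for i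
      unfolding rk_def
    proof (rule sum_nonneg)
      show "0 \<le> (fl i j (X v $ i) - fl i j 0) + (ce i j (X v $ i) - ce i j 0)" for j
        using mono(1)[OF X01(1), of i j v i] mono(2)[OF X01(1), of i j v i] by linarith
    qed
    ultimately show ?thesis by (auto simp: PiE_iff mult.commute)
  qed
  have rk_eq: "fl i j (X v $ i) = fl i j (X v' $ i) \<and> ce i j (X v $ i) = ce i j (X v' $ i)"
    if "rk v i = rk v' i" "X v $ i \<le> X v' $ i" "j < n" for v v' i j
  proof -
    let ?d = "\<lambda>j. (fl i j (X v' $ i) - fl i j (X v $ i)) + (ce i j (X v' $ i) - ce i j (X v $ i))"
    have "(\<Sum>j<n. ?d j) = rk v' i - rk v i"
      unfolding rk_def by (simp add: sum_subtractf sum.distrib)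
    then have "(\<Sum>j<n. ?d j) = 0" using that(1) by simp
    moreover have "0 \<le> ?d j" for j using mono[OF that(2), of i j] by simp
    ultimately have "?d j = 0"
      using sum_nonneg_eq_0_iff[of "{..<n}" ?d] that(3) by simp
    then show ?thesis using mono[OF that(2), of i j] by simp
  qed
  have det: "visits n v = visits n v'" if v: "v \<in> reg" "v' \<in> reg" "rk v = rk v'" for v v'
  proof -
    have iff: "R (int j) v \<in> U 1 \<longleftrightarrow> (\<forall>i. ce i j (X v $ i) \<le> fl i j (X v $ i))" if "v \<in> reg" for v j
    proof -
      have Rv: "R (int j) v = torus_proj (X v + real j *\<^sub>R a)"
        using projX[of v] by (metis of_int_of_nat_eq rotation_proj)
      have "R (int j) v \<in> U 1 \<longleftrightarrow> R (int j) v \<in> torus_proj ` cbox l u"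
        using reg_in_U[OF that one_in, of "int j"] P'[OF one_in] box by simp
      also have "\<dots> \<longleftrightarrow> torus_proj (X v + real j *\<^sub>R a) \<in> torus_proj ` cbox l u"
        by (simp only: Rv)
      finally show ?thesis by (simp add: mem_proj_cbox_iff fl_def ce_def)
    qed
    have "fl i j (X v $ i) = fl i j (X v' $ i) \<and> ce i j (X v $ i) = ce i j (X v' $ i)" if "j < n" for i j
      using rk_eq[of v i v' j] rk_eq[of v' i v j] v(3) that by (metis linear)
    then show ?thesis using iff[OF v(1)] iff[OF v(2)] by (simp add: visits_def cong: conj_cong)
  qed
  have fin: "finite ((UNIV :: 'd set) \<rightarrow>\<^sub>E {0..int (2 * n)})" by (intro finite_PiE) auto
  have "visits n ` reg \<subseteq> (\<lambda>r. visits n (SOME v. v \<in> reg \<and> rk v = r)) ` rk ` reg"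
  proof
    fix A assume "A \<in> visits n ` reg"
    then obtain v where v: "v \<in> reg" "A = visits n v" by blast
    have "(SOME v'. v' \<in> reg \<and> rk v' = rk v) \<in> reg \<and> rk (SOME v'. v' \<in> reg \<and> rk v' = rk v) = rk v"
      by (rule someI[of "\<lambda>v'. v' \<in> reg \<and> rk v' = rk v" v]) (use v in simp)
    then have "visits n (SOME v'. v' \<in> reg \<and> rk v' = rk v) = visits n v"
      using det v(1) by blast
    then show "A \<in> (\<lambda>r. visits n (SOME v. v \<in> reg \<and> rk v = r)) ` rk ` reg" using v by blast
  qed
  moreover have rf: "finite (rk ` reg)" by (rule finite_subset[OF _ fin]) (use rk_range in blast)
  ultimately have "card (visits n ` reg) \<le> card (rk ` reg)" by (intro surj_card_le)
  also have "\<dots> \<le> card ((UNIV :: 'd set) \<rightarrow>\<^sub>E {0..int (2 * n)})"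
    using rk_range by (intro card_mono fin) blast
  also have "\<dots> = (2 * n + 1) ^ CARD('d)"
    by (subst card_PiE) (auto simp: nat_add_distrib nat_mult_distrib)
  finally show ?thesis .
qed

lemma polynomial_bound:
  assumes box: "P' 1 = cbox l u" and n: "n \<ge> 1"
  shows "real (card (visits n ` reg)) \<le> 3 ^ CARD('d) * real n ^ CARD('d)"
proof -
  have "card (visits n ` reg) \<le> (3 * n) ^ CARD('d)"
    using card_visits_le[OF box, of n] power_mono[of "2 * n + 1" "3 * n" "CARD('d)"] n by linarith
  then have "real (card (visits n ` reg)) \<le> real ((3 * n) ^ CARD('d))" by (simp only: of_nat_le_iff)
  then show ?thesis by (simp add: power_mult_distrib)
qed

lemma htop_\<beta>:
  assumes box: "P' 1 = cbox l u"
  shows "htop_cover (top_of_set Z) left_shift \<beta> = 0"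
proof -
  let ?c = "\<lambda>n. card (visits n ` reg)"
  let ?b = "\<lambda>n. real CARD('d) * (ln 3 / real n + ln (real n) / real n)"
  have upper: "ln (real (?c n)) / real n \<le> ?b n" if "n \<ge> 1" for n
  proof -
    have "0 < ?c n" using card_visits_ge[OF that] by simp
    moreover have "real (?c n) \<le> (3 * real n) ^ CARD('d)"
      using polynomial_bound[OF box that] by (simp add: power_mult_distrib)
    ultimately have "ln (real (?c n)) \<le> ln ((3 * real n) ^ CARD('d))" using that by simp
    also have "\<dots> = real CARD('d) * ln (3 * real n)" by (rule ln_realpow)
    also have "\<dots> = real CARD('d) * (ln 3 + ln (real n))" using that by (simp add: ln_mult)
    finally have "ln (real (?c n)) / real n \<le> real CARD('d) * (ln 3 + ln (real n)) / real n"
      by (rule divide_right_mono) simp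
    then show ?thesis by (simp only: add_divide_distrib[symmetric] times_divide_eq_right)
  qed
  have lower: "0 \<le> ln (real (?c n)) / real n" if "n \<ge> 1" for n
    using card_visits_ge[OF that] by simp
  have "(\<lambda>n. ln (real (?c n)) / real n) \<longlonglongrightarrow> 0"
  proof (rule tendsto_sandwich)
    show "\<forall>\<^sub>F n in sequentially. 0 \<le> ln (real (?c n)) / real n"
      by (rule eventually_sequentiallyI[of 1]) (rule lower)
    show "\<forall>\<^sub>F n in sequentially. ln (real (?c n)) / real n \<le> ?b n"
      by (rule eventually_sequentiallyI[of 1]) (rule upper)
    show "?b \<longlonglongrightarrow> 0"
      by (intro tendsto_mult_right_zero tendsto_add_zero lim_const_over_n lim_ln_over_n)
  qed (rule tendsto_const)
  then show ?thesis unfolding htop_cover_def subcover_number_eq by (rule limI)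
qed

end

section \<open>Mean dimension of the hub-and-spoke system\<close>

theorem theorem4p5:
  fixes a :: "real ^ 'd::finite"
    and k :: nat
    and U :: "nat \<Rightarrow> 'd torus set"
    and P' :: "nat \<Rightarrow> (real ^ 'd) set"
    and p :: "nat \<Rightarrow> real ^ 2"
    and Z :: "(int \<Rightarrow> real ^ 2) topology"
  assumes "k \<ge> 2"
    and "rationally_independent_with_one a"
    and "\<And>i. i \<in> {1..k} \<Longrightarrow> open (U i) \<and> U i \<noteq> {}"
    and "\<And>i j. i \<in> {1..k} \<Longrightarrow> j \<in> {1..k} \<Longrightarrow> i \<noteq> j \<Longrightarrow> U i \<inter> U j = {}"
    and "(\<Union>i\<in>{1..k}. closure (U i)) = UNIV"
    and "\<And>i. i \<in> {1..k} \<Longrightarrow> U i = interior (closure (U i))"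
    and "\<And>i. i \<in> {1..k} \<Longrightarrow> compact (P' i) \<and> convex (P' i) \<and>
           torus_proj ` P' i = closure (U i) \<and> diameter (P' i) < 1 / 2"
    and "inj_on p {1..k}"
    and "\<And>i. i \<in> {1..k} \<Longrightarrow> p i \<in> sphere 0 1"
    and "Z = top_of_set (Spoke p (coding_system a k U))"
  shows "has_CPMD TYPE('b) Z left_shift
    \<and> \<not> has_UPMD Z left_shift
    \<and> (\<exists>\<beta>. standard_open_cover Z \<beta>
         \<and> mdim_cover Z left_shift \<beta> = 0
         \<and> (\<forall>n\<ge>1. subcover_number Z (iterated_cover Z left_shift \<beta> n) \<ge> n + 1)
         \<and> ((\<forall>i\<in>{1..k}. \<exists>l u. P' i = cbox l u) \<longrightarrow>
              (\<exists>C::real. C > 0 \<and> (\<forall>n\<ge>1.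
                 real (subcover_number Z (iterated_cover Z left_shift \<beta> n)) \<le> C * real n ^ CARD('d)))
              \<and> htop_cover Z left_shift \<beta> = 0))
    \<and> ((\<forall>i\<in>{1..k}. \<exists>l u. P' i = cbox l u) \<longrightarrow>
         \<not> has_UPMD Z left_shift \<and> \<not> has_UPE Z left_shift)"
proof -
  interpret rotation_coding a k U P' p
    using assms(1-9) by unfold_locales
  note Z = assms(10)
  have UPMD: "\<not> has_UPMD Z left_shift"
    unfolding has_UPMD_def Z using standard_\<beta> mdim_\<beta> by (metis less_irrefl)
  have entropy: "htop_cover Z left_shift \<beta> = 0"
    and growth: "\<exists>C::real. C > 0 \<and> (\<forall>n\<ge>1.
      real (subcover_number Z (iterated_cover Z left_shift \<beta> n)) \<le> C * real n ^ CARD('d))"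
    if boxes: "\<forall>i\<in>{1..k}. \<exists>l u. P' i = cbox l u"
  proof -
    obtain l u where box: "P' 1 = cbox l u" using boxes one_in by blast
    show "htop_cover Z left_shift \<beta> = 0" unfolding Z by (rule htop_\<beta>[OF box])
    show "\<exists>C::real. C > 0 \<and> (\<forall>n\<ge>1.
      real (subcover_number Z (iterated_cover Z left_shift \<beta> n)) \<le> C * real n ^ CARD('d))"
      unfolding Z subcover_number_eq using polynomial_bound[OF box]
      by (intro exI[of _ "3 ^ CARD('d)"]) simp
  qed
  have UPE: "\<not> has_UPE Z left_shift" if "\<forall>i\<in>{1..k}. \<exists>l u. P' i = cbox l u"
    using entropy[OF that] standard_\<beta> unfolding has_UPE_def Z by (metis less_irrefl)
  have "standard_open_cover Z \<beta> \<and> mdim_cover Z left_shift \<beta> = 0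
    \<and> (\<forall>n\<ge>1. subcover_number Z (iterated_cover Z left_shift \<beta> n) \<ge> n + 1)"
    unfolding Z subcover_number_eq using standard_\<beta> mdim_\<beta> card_visits_ge by blast
  moreover have "has_CPMD TYPE('b) Z left_shift" unfolding Z by (rule CPMD)
  ultimately show ?thesis using UPMD UPE entropy growth by blast
qed

end
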